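(* Let $R$ be a finite chain ring with maximal ideal $\mathfrak{m}$, let $q=|R/\mathfrak{m}|$, and let $S=R[x]/(h)$, where $h\in R[x]$ is monic of degree $m$ and irreducible modulo $\mathfrak{m}$. Let $\sigma$ be a generator of the Galois group of $R\subseteq S$ as described in the context. Let $n_1,\ldots,n_\ell$ be positive integers and $n=n_1+\cdots+n_\ell$. Let $\mathbf{a}=(a_1,\ldots,a_\ell)\in(S^* )^\ell$ and $\boldsymbol\beta=(\boldsymbol\beta_1,\ldots,\boldsymbol\beta_\ell)$ with $\boldsymbol\beta_i=(\beta_{i,1},\ldots,\beta_{i,n_i})\in S^{n_i}$, and assume that (i) $a_i-a_j^{\beta}\in S^*$ for all $\beta\in S^*$ and all $1\le i<j\le \ell$, and (ii) for each $i$, the elements $\beta_{i,1},\ldots,\beta_{i,n_i}$ are linearly independent over $R$. For $k\in\{1,\ldots,n\}$, let $\mathcal{C}_k(\mathbf{a},\boldsymbol\beta)\subseteq S^n$ be the $S$-submodule of $S^n$ generated by the rows of the $k\times n$ matrix $M_k(\mathbf{a},\boldsymbol\beta)$ whose row $s$ ($s=0,1,\ldots,k-1$) is $$\big(\mathcal{D}_{a_1}^s(\beta_{1,1}),\ldots,\mathcal{D}_{a_1}^s(\beta_{1,n_1}),\ldots,\mathcal{D}_{a_\ell}^s(\beta_{\ell,1}),\ldots,\mathcal{D}_{a_\ell}^s(\beta_{\ell,n_\ell})\big).$$ Then $\mathcal{C}_k(\mathbf{a},\boldsymbol\beta)$ is a free $S$-module of rank $k$ and is a maximum sum-rank distance (MSRD)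 code over $R$ for the length partition $n=n_1+\cdots+n_\ell$.
   Context: $R$ is a finite commutative chain ring (a finite local ring whose ideals are totally ordered by inclusion), with maximal ideal $\mathfrak{m}$ and residue field $\mathbb{F}_q=R/\mathfrak{m}$. $S=R[x]/(h)$ is a free local Galois extension of $R$ of rank $m$ with maximal ideal $\mathfrak{M}=\mathfrak{m}S$ and $S/\mathfrak{M}=\mathbb{F}_{q^m}$; $S^*=S\setminus\mathfrak{M}$ is its unit group. $\sigma:S\to S$ is a ring automorphism generating the (cyclic, order $m$) Galois group of $R\subseteq S$, with fixed ring $R$, and reducing modulo $\mathfrak{M}$ to the Frobenius $y\mapsto y^q$ of $\mathbb{F}_{q^m}$. For $a\in S$ and $i\in\mathbb{N}$, $N_i(a)=\sigma^{i-1}(a)\cdots\sigma(a)a$ (with $N_0(a)=1$) and $\mathcal{D}_a^i(\beta)=\sigma^i(\beta)N_i(a)$ for $\beta\in S$ (so $\mathcal{D}_a^0$ is the identity). For $a\in S$, $\beta\in S^*$, $a^\beta=\sigma(\beta)a\beta^{-1}$. Rank: for $\mathbf{u}\in S^t$, fix an $R$-basis $\alpha_1,\ldots,\alpha_m$ of $S$ and write $\mathbf{u}=\sum_{i=1}^m\alpha_i(c_{i,1},\ldots,c_{i,t})$ with $c_{i,j}\in R$; ${\rm rk}(\mathbf{u})$ is the number of nonzero diagonal entries of the Smith normal form of the $m\times t$ matrix $(c_{i,j})$ over $R$ (independent of the basis). For $\mathbf{c}=(\mathbf{c}^{(1)},\ldots,\mathbf{c}^{(\ell)})\in S^n$ with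 $\mathbf{c}^{(i)}\in S^{n_i}$, the sum-rank weight is ${\rm wt}_{SR}(\mathbf{c})=\sum_i{\rm rk}(\mathbf{c}^{(i)})$, the sum-rank distance is ${\rm d}_{SR}(\mathbf{c},\mathbf{d})={\rm wt}_{SR}(\mathbf{c}-\mathbf{d})$, and ${\rm d}_{SR}(\mathcal{C})$ is the minimum distance between distinct codewords. A code $\mathcal{C}\subseteq S^n$ is MSRD (over $R$, for this partition) if $k=\log_{|S|}|\mathcal{C}|$ is a positive integer and ${\rm d}_{SR}(\mathcal{C})=n-k+1$. *)

theory Defs
  imports "HOL-Computational_Algebra.Polynomial" "Jordan_Normal_Form.Matrix"
begin

definition is_ideal :: "'a::comm_ring_1 set \<Rightarrow> bool" where
  "is_ideal I \<longleftrightarrow> 0 \<in> I \<and> (\<forall>x\<in>I. \<forall>y\<in>I. x + y \<in> I) \<and> (\<forall>r. \<forall>x\<in>I. r * x \<in> I)"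

text \<open>A finite commutative chain ring: a finite local ring whose ideals are totally
  ordered by inclusion (finiteness is imposed separately).\<close>
definition chain_ring :: "'a::comm_ring_1 itself \<Rightarrow> bool" where
  "chain_ring TYPE('a) \<longleftrightarrow> (0::'a) \<noteq> 1 \<and>
     (\<forall>I J :: 'a set. is_ideal I \<longrightarrow> is_ideal J \<longrightarrow> I \<subseteq> J \<or> J \<subseteq> I)"

definition maximal_ideal :: "'a::comm_ring_1 set \<Rightarrow> bool" where
  "maximal_ideal I \<longleftrightarrow> is_ideal I \<and> I \<noteq> UNIV \<and>
     (\<forall>J. is_ideal J \<longrightarrow> I \<subseteq> J \<longrightarrow> J = I \<or> J = UNIV)"

definition max_ideal :: "'a::comm_ring_1 set" where
  "max_ideal = (THE I. maximal_ideal I)"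

definition residue_card :: "'a::comm_ring_1 set \<Rightarrow> nat" where
  "residue_card I = card ((\<lambda>r. {r'. r - r' \<in> I}) ` UNIV)"

definition is_ring_hom :: "('a::comm_ring_1 \<Rightarrow> 'b::comm_ring_1) \<Rightarrow> bool" where
  "is_ring_hom f \<longleftrightarrow> f 1 = 1 \<and> (\<forall>x y. f (x + y) = f x + f y) \<and> (\<forall>x y. f (x * y) = f x * f y)"

definition is_ring_aut :: "('a::comm_ring_1 \<Rightarrow> 'a) \<Rightarrow> bool" where
  "is_ring_aut f \<longleftrightarrow> bij f \<and> is_ring_hom f"

definition ext_ideal :: "('r::comm_ring_1 \<Rightarrow> 's::comm_ring_1) \<Rightarrow> 'r set \<Rightarrow> 's set" where
  "ext_ideal \<iota> I = {x. \<exists>k (r::nat \<Rightarrow> 'r) (t::nat \<Rightarrow> 's). (\<forall>j<k. r j \<in> I) \<and> x = (\<Sum>j<k. \<iota> (r j) * t j)}"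

section \<open>Irreducibility modulo an ideal (i.e. of the reduction in (R/I)[x], R/I a field)\<close>

definition poly_zero_mod :: "'a::comm_ring_1 set \<Rightarrow> 'a poly \<Rightarrow> bool" where
  "poly_zero_mod I f \<longleftrightarrow> (\<forall>i. coeff f i \<in> I)"

text \<open>f reduces to a unit of (R/I)[x] with R/I a field: a nonzero constant.\<close>
definition poly_unit_mod :: "'a::comm_ring_1 set \<Rightarrow> 'a poly \<Rightarrow> bool" where
  "poly_unit_mod I f \<longleftrightarrow> coeff f 0 \<notin> I \<and> (\<forall>i>0. coeff f i \<in> I)"

definition poly_cong_mod :: "'a::comm_ring_1 set \<Rightarrow> 'a poly \<Rightarrow> 'a poly \<Rightarrow> bool" where
  "poly_cong_mod I f g \<longleftrightarrow> (\<forall>i. coeff f i - coeff g i \<in> I)"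

definition irreducible_mod :: "'a::comm_ring_1 set \<Rightarrow> 'a poly \<Rightarrow> bool" where
  "irreducible_mod I h \<longleftrightarrow> \<not> poly_zero_mod I h \<and> \<not> poly_unit_mod I h \<and>
     (\<forall>f g. poly_cong_mod I h (f * g) \<longrightarrow> poly_unit_mod I f \<or> poly_unit_mod I g)"

definition Nnorm :: "('s::comm_ring_1 \<Rightarrow> 's) \<Rightarrow> nat \<Rightarrow> 's \<Rightarrow> 's" where
  "Nnorm \<sigma> i a = (\<Prod>j<i. (\<sigma> ^^ j) a)"

definition Dop :: "('s::comm_ring_1 \<Rightarrow> 's) \<Rightarrow> 's \<Rightarrow> nat \<Rightarrow> 's \<Rightarrow> 's" where
  "Dop \<sigma> a i \<beta> = (\<sigma> ^^ i) \<beta> * Nnorm \<sigma> i a"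

definition sinv :: "'s::comm_ring_1 \<Rightarrow> 's" where
  "sinv b = (SOME c. b * c = 1)"

definition sconj :: "('s::comm_ring_1 \<Rightarrow> 's) \<Rightarrow> 's \<Rightarrow> 's \<Rightarrow> 's" where
  "sconj \<sigma> a \<beta> = \<sigma> \<beta> * a * sinv \<beta>"

definition coords :: "('r::comm_ring_1 \<Rightarrow> 's::comm_ring_1) \<Rightarrow> (nat \<Rightarrow> 's) \<Rightarrow> nat \<Rightarrow> 's \<Rightarrow> nat \<Rightarrow> 'r" where
  "coords \<iota> b m s = (THE c. (\<forall>i\<ge>m. c i = 0) \<and> s = (\<Sum>i<m. \<iota> (c i) * b i))"

definition snf_rank :: "'r::comm_ring_1 mat \<Rightarrow> nat" where
  "snf_rank A = (SOME r. \<exists>P Q D.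
     P \<in> carrier_mat (dim_row A) (dim_row A) \<and> invertible_mat P \<and>
     Q \<in> carrier_mat (dim_col A) (dim_col A) \<and> invertible_mat Q \<and>
     D = P * A * Q \<and>
     (\<forall>i j. i < dim_row A \<longrightarrow> j < dim_col A \<longrightarrow> i \<noteq> j \<longrightarrow> D $$ (i, j) = 0) \<and>
     (\<forall>i. Suc i < min (dim_row A) (dim_col A) \<longrightarrow> D $$ (i, i) dvd D $$ (Suc i, Suc i)) \<and>
     r = card {i. i < min (dim_row A) (dim_col A) \<and> D $$ (i, i) \<noteq> 0})"

definition rk :: "('r::comm_ring_1 \<Rightarrow> 's::comm_ring_1) \<Rightarrow> (nat \<Rightarrow> 's) \<Rightarrow> nat \<Rightarrow> (nat \<Rightarrow> 's) \<Rightarrow> nat \<Rightarrow> nat" where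
  "rk \<iota> b m u t = snf_rank (mat m t (\<lambda>(i, j). coords \<iota> b m (u j) i))"

text \<open>Vectors of S^n, n = n_0 + ... + n_{l-1}, are represented blockwise:
  c i j is the j-th entry of the i-th block (i < l, j < ns i), and 0 elsewhere.\<close>
definition wt_SR :: "('r::comm_ring_1 \<Rightarrow> 's::comm_ring_1) \<Rightarrow> (nat \<Rightarrow> 's) \<Rightarrow> nat \<Rightarrow> nat \<Rightarrow> (nat \<Rightarrow> nat)
    \<Rightarrow> (nat \<Rightarrow> nat \<Rightarrow> 's) \<Rightarrow> nat" where
  "wt_SR \<iota> b m l ns c = (\<Sum>i<l. rk \<iota> b m (c i) (ns i))"

definition d_SR :: "('r::comm_ring_1 \<Rightarrow> 's::comm_ring_1) \<Rightarrow> (nat \<Rightarrow> 's) \<Rightarrow> nat \<Rightarrow> nat \<Rightarrow> (nat \<Rightarrow> nat)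
    \<Rightarrow> (nat \<Rightarrow> nat \<Rightarrow> 's) set \<Rightarrow> nat" where
  "d_SR \<iota> b m l ns C = Min {wt_SR \<iota> b m l ns (\<lambda>i j. c i j - d i j) | c d. c \<in> C \<and> d \<in> C \<and> c \<noteq> d}"

definition is_MSRD :: "('r::comm_ring_1 \<Rightarrow> 's::comm_ring_1) \<Rightarrow> (nat \<Rightarrow> 's) \<Rightarrow> nat \<Rightarrow> nat \<Rightarrow> (nat \<Rightarrow> nat)
    \<Rightarrow> (nat \<Rightarrow> nat \<Rightarrow> 's) set \<Rightarrow> bool" where
  "is_MSRD \<iota> b m l ns C \<longleftrightarrow> (\<exists>k::nat. k > 0 \<and> card C = card (UNIV :: 's set) ^ k \<and>
      int (d_SR \<iota> b m l ns C) = int (\<Sum>i<l. ns i) - int k + 1)"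

definition lincomb :: "nat \<Rightarrow> (nat \<Rightarrow> 's::comm_ring_1) \<Rightarrow> (nat \<Rightarrow> nat \<Rightarrow> nat \<Rightarrow> 's) \<Rightarrow> nat \<Rightarrow> nat \<Rightarrow> 's" where
  "lincomb k coef v = (\<lambda>i j. \<Sum>t<k. coef t * v t i j)"

definition span_S :: "nat \<Rightarrow> (nat \<Rightarrow> nat \<Rightarrow> nat \<Rightarrow> 's::comm_ring_1) \<Rightarrow> (nat \<Rightarrow> nat \<Rightarrow> 's) set" where
  "span_S k v = {lincomb k coef v | coef. True}"

definition free_of_rank :: "(nat \<Rightarrow> nat \<Rightarrow> 's::comm_ring_1) set \<Rightarrow> nat \<Rightarrow> bool" where
  "free_of_rank C k \<longleftrightarrow> (\<exists>v. (\<forall>t<k. v t \<in> C) \<and> C = span_S k v \<and>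
      (\<forall>coef. lincomb k coef v = (\<lambda>i j. 0) \<longrightarrow> (\<forall>t<k. coef t = 0)))"

definition Mrow :: "('s::comm_ring_1 \<Rightarrow> 's) \<Rightarrow> nat \<Rightarrow> (nat \<Rightarrow> nat) \<Rightarrow> (nat \<Rightarrow> 's) \<Rightarrow> (nat \<Rightarrow> nat \<Rightarrow> 's)
    \<Rightarrow> nat \<Rightarrow> nat \<Rightarrow> nat \<Rightarrow> 's" where
  "Mrow \<sigma> l ns a \<beta> s = (\<lambda>i j. if i < l \<and> j < ns i then Dop \<sigma> (a i) s (\<beta> i j) else 0)"

definition code_C :: "('s::comm_ring_1 \<Rightarrow> 's) \<Rightarrow> nat \<Rightarrow> (nat \<Rightarrow> nat) \<Rightarrow> (nat \<Rightarrow> 's) \<Rightarrow> (nat \<Rightarrow> nat \<Rightarrow> 's)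
    \<Rightarrow> nat \<Rightarrow> (nat \<Rightarrow> nat \<Rightarrow> 's) set" where
  "code_C \<sigma> l ns a \<beta> k = span_S k (Mrow \<sigma> l ns a \<beta>)"

end

theory Submission
  imports Defs "Jordan_Normal_Form.Column_Operations"
begin

text \<open>A Smith normal form \<open>P A Q\<close> of the coordinate matrix of a block turns its rank into the number
  of nonzero entries of the block multiplied by \<open>Q\<close>. As the operators \<open>\<D>\<^sub>a\<close> are linear over the base
  ring, multiplying by \<open>Q\<close> only replaces the evaluation points by other independent ones, so the lower
  bound on the sum-rank weight is a bound on the number of zeros of a skew polynomial. Dividing the
  coefficients by the largest possible power of the uniformizer reduces that bound to the residue
  field, where it follows by induction from right division by linear factors.

  The bound is attained by a codeword that vanishes on \<open>k - 1\<close> positions, multiplied into the socle.\<close>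

section \<open>Smith normal form\<close>

text \<open>\<open>snf_rank\<close> selects some Smith form by choice, and its uniqueness is never
  proved: every bound holds for whichever form was selected. It suffices that the rank counts the
  nonzero columns of \<open>A * Q\<close> and that a relation between the columns has a non-unit
  coefficient at each nonzero one. The residue field is never built as a type. Congruences become
  divisibility by the image \<open>p\<close> of the uniformizer, and two properties carry the
  argument: elements not divisible by \<open>p\<close> are units, and elements fixed by
  \<open>\<sigma>\<close> modulo \<open>p\<close> are congruent to base elements. Both rest on the
  Frobenius congruence. The induction on linear factors has to run modulo \<open>p\<close> because
  it inverts roots and their combinations; over the ring itself a nonzero combination may be a zero
  divisor. Independence over the base ring passes to independence modulo \<open>p\<close> on
  multiplying a congruence by a nonzero element that the uniformizer kills. In the upper bound all
  entries are killed by \<open>p\<close>, so only residues of coefficients matter and counting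
  replaces linear algebra.\<close>

lemma invertible_matI:
  assumes "A \<in> carrier_mat n n" "B \<in> carrier_mat n n" "A * B = 1\<^sub>m n" "B * A = 1\<^sub>m n"
  shows "invertible_mat A"
  using assms unfolding invertible_mat_def inverts_mat_def by auto

lemma invertible_one_mat: "invertible_mat (1\<^sub>m n)"
  by (rule invertible_matI[of _ n "1\<^sub>m n"]) auto

lemma invertible_matE:
  assumes "invertible_mat A" "A \<in> carrier_mat n n"
  obtains B where "B \<in> carrier_mat n n" "A * B = 1\<^sub>m n" "B * A = 1\<^sub>m n"
proof -
  obtain B where AB: "A * B = 1\<^sub>m n" and BA: "B * A = 1\<^sub>m (dim_row B)"
    using assms unfolding invertible_mat_def inverts_mat_def by auto
  have "dim_col B = n" using AB by (metis index_mult_mat(3) index_one_mat(3))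
  moreover have "dim_row B = n"
    using BA assms(2) by (metis carrier_matD(2) index_mult_mat(3) index_one_mat(3))
  ultimately show thesis using that AB BA by auto
qed

lemma invertible_mat_mult:
  assumes A: "A \<in> carrier_mat n n" "invertible_mat A"
    and B: "B \<in> carrier_mat n n" "invertible_mat (B :: 'a::semiring_1 mat)"
  shows "invertible_mat (A * B)"
proof -
  obtain A' where A': "A' \<in> carrier_mat n n" "A * A' = 1\<^sub>m n" "A' * A = 1\<^sub>m n"
    using invertible_matE A by blast
  obtain B' where B': "B' \<in> carrier_mat n n" "B * B' = 1\<^sub>m n" "B' * B = 1\<^sub>m n"
    using invertible_matE B by blast
  have "A * B * (B' * A') = A * (B * B') * A'"
    using A(1) B(1) A'(1) B'(1) by (simp add: assoc_mult_mat[of _ n n _ n _ n])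
  moreover have "B' * A' * (A * B) = B' * (A' * A) * B"
    using A(1) B(1) A'(1) B'(1) by (simp add: assoc_mult_mat[of _ n n _ n _ n])
  ultimately show ?thesis
    using A B A' B' by (intro invertible_matI[of _ n "B' * A'"]) auto
qed

lemma invertible_swaprows_mat:
  assumes "k < n" "l < n"
  shows "invertible_mat (swaprows_mat n k l :: 'a::semiring_1 mat)"
  using swaprows_mat_inv[OF assms] by (intro invertible_matI[of _ n "swaprows_mat n k l"]) auto

text \<open>Entries of \<open>P * A * Q\<close> are combinations of entries of \<open>A\<close>, so
  a common divisor survives row and column operations. This later yields the divisibility chain on
  the diagonal.\<close>

lemma dvd_mult_mat:
  fixes A :: "'a::comm_ring_1 mat"
  assumes P: "P \<in> carrier_mat m m'" and A: "A \<in> carrier_mat m' n'" and Q: "Q \<in> carrier_mat n' n"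
    and d: "\<And>i j. i < m' \<Longrightarrow> j < n' \<Longrightarrow> d dvd A $$ (i, j)" and ij: "i < m" "j < n"
  shows "d dvd (P * A * Q) $$ (i, j)"
proof -
  have "d dvd (P * A) $$ (i, l)" if "l < n'" for l
    using P A d ij that by (auto simp: scalar_prod_def intro!: dvd_sum dvd_mult)
  moreover have "(P * A * Q) $$ (i, j) = (\<Sum>l<n'. (P * A) $$ (i, l) * Q $$ (l, j))"
    using P A Q ij by (subst index_mult_mat(1)) (auto simp: scalar_prod_def atLeast0LessThan)
  ultimately show ?thesis by (auto intro!: dvd_sum dvd_mult2)
qed

section \<open>Diagonalization over a ring with total divisibility\<close>

definition is_snf :: "'a::comm_ring_1 mat \<Rightarrow> bool" where
  "is_snf D \<longleftrightarrow> (\<forall>i j. i < dim_row D \<longrightarrow> j < dim_col D \<longrightarrow> i \<noteq> j \<longrightarrow> D $$ (i, j) = 0) \<and>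
     (\<forall>i. Suc i < min (dim_row D) (dim_col D) \<longrightarrow> D $$ (i, i) dvd D $$ (Suc i, Suc i))"

lemma ex_dvd_all:
  fixes X :: "'a::comm_ring_1 set"
  assumes tot: "\<And>x y :: 'a. x dvd y \<or> y dvd x" and "finite X" "X \<noteq> {}"
  shows "\<exists>x\<in>X. \<forall>y\<in>X. x dvd y"
  using assms(2,3)
proof (induction X rule: finite_ne_induct)
  case (insert z X)
  then obtain x where "x \<in> X" "\<forall>y\<in>X. x dvd y" by blast
  with tot[of x z] show ?case by (metis dvd_refl dvd_trans insert_iff)
qed auto

lemma ex_entry_dvd_all:
  fixes A :: "'a::comm_ring_1 mat"
  assumes tot: "\<And>x y :: 'a. x dvd y \<or> y dvd x"
  shows "\<exists>p q. p < Suc m \<and> q < Suc n \<and> (\<forall>i<Suc m. \<forall>j<Suc n. A $$ (p, q) dvd A $$ (i, j))"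
proof -
  from ex_dvd_all[OF tot, of "(\<lambda>(i, j). A $$ (i, j)) ` ({..<Suc m} \<times> {..<Suc n})"]
  show ?thesis by fastforce
qed

text \<open>The corner divides its row and column, so these are \<open>E * V\<close> and
  \<open>U * E\<close>, and unipotent block triangular matrices clear them. The remaining block is a
  Schur complement that needs no inverse of the corner.\<close>

lemma block_elimination:
  fixes A :: "'a::comm_ring_1 mat"
  assumes A: "A \<in> carrier_mat (Suc m) (Suc n)"
    and d: "\<And>i j. i < Suc m \<Longrightarrow> j < Suc n \<Longrightarrow> A $$ (0, 0) dvd A $$ (i, j)"
  obtains P Q B where "P \<in> carrier_mat (Suc m) (Suc m)" "invertible_mat P"
    "Q \<in> carrier_mat (Suc n) (Suc n)" "invertible_mat Q" "B \<in> carrier_mat m n"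
    "P * A * Q = four_block_mat (mat 1 1 (\<lambda>_. A $$ (0, 0))) (0\<^sub>m 1 n) (0\<^sub>m m 1) B"
proof -
  obtain e where e: "\<And>i j. i < Suc m \<Longrightarrow> j < Suc n \<Longrightarrow> A $$ (i, j) = A $$ (0, 0) * e i j"
    using d unfolding dvd_def by metis
  define E where "E = mat 1 1 (\<lambda>_. A $$ (0, 0))"
  define U where "U = mat m 1 (\<lambda>(i, _). e (Suc i) 0)"
  define V where "V = mat 1 n (\<lambda>(_, j). e 0 (Suc j))"
  define C where "C = mat m n (\<lambda>(i, j). A $$ (Suc i, Suc j))"
  define lo where "lo = (\<lambda>X :: 'a mat. four_block_mat (1\<^sub>m 1) (0\<^sub>m 1 m) X (1\<^sub>m m))"
  define up where "up = (\<lambda>X :: 'a mat. four_block_mat (1\<^sub>m 1) X (0\<^sub>m n 1) (1\<^sub>m n))"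
  have car: "E \<in> carrier_mat 1 1" "U \<in> carrier_mat m 1" "V \<in> carrier_mat 1 n" "C \<in> carrier_mat m n"
    by (auto simp: E_def U_def V_def C_def)
  have e0: "\<And>j. j < n \<Longrightarrow> A $$ (0, Suc j) = A $$ (0, 0) * e 0 (Suc j)"
    "\<And>i. i < m \<Longrightarrow> A $$ (Suc i, 0) = A $$ (0, 0) * e (Suc i) 0"
    using e by (meson zero_less_Suc Suc_mono)+
  have A_eq: "A = four_block_mat E (E * V) (U * E) C"
    using A e0 by (intro eq_matI) (auto simp: E_def U_def V_def C_def scalar_prod_def
      less_Suc_eq_0_disj mult.commute)
  \<comment> \<open>\<open>lo\<close> and \<open>up\<close> turn addition of blocks into
    multiplication, so negating the block gives the inverse.\<close>
  have lo: "lo X * lo Y = lo (X + Y)" if "X \<in> carrier_mat m 1" "Y \<in> carrier_mat m 1" for X Y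
    unfolding lo_def using that
    by (subst mult_four_block_mat[of _ 1 1 _ m _ m _ _ 1 _ m]) auto
  have up: "up X * up Y = up (Y + X)" if "X \<in> carrier_mat 1 n" "Y \<in> carrier_mat 1 n" for X Y
    unfolding up_def using that
    by (subst mult_four_block_mat[of _ 1 1 _ n _ n _ _ 1 _ n]) auto
  have lo_car: "lo X \<in> carrier_mat (Suc m) (Suc m)" if "X \<in> carrier_mat m 1" for X
    using that four_block_carrier_mat[of "1\<^sub>m 1" 1 1 "1\<^sub>m m" m m] by (simp add: lo_def)
  have up_car: "up X \<in> carrier_mat (Suc n) (Suc n)" if "X \<in> carrier_mat 1 n" for X
    using that four_block_carrier_mat[of "1\<^sub>m 1" 1 1 "1\<^sub>m n" n n] by (simp add: up_def)
  have lo0: "lo (0\<^sub>m m 1) = 1\<^sub>m (Suc m)" and up0: "up (0\<^sub>m 1 n) = 1\<^sub>m (Suc n)"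
    using four_block_one_mat[of 1 m] four_block_one_mat[of 1 n] by (simp_all add: lo_def up_def)
  have Uz: "U + - U = 0\<^sub>m m 1" "- U + U = 0\<^sub>m m 1" and Vz: "V + - V = 0\<^sub>m 1 n" "- V + V = 0\<^sub>m 1 n"
    using car by auto
  have P: "invertible_mat (lo (- U))"
    using car lo_car by (intro invertible_matI[of _ "Suc m" "lo U"]) (auto simp: lo Uz lo0 lo0[unfolded One_nat_def])
  have Q: "invertible_mat (up (- V))"
    using car up_car by (intro invertible_matI[of _ "Suc n" "up V"]) (auto simp: up Vz up0 up0[unfolded One_nat_def])
  have "lo (- U) * A = four_block_mat E (E * V) (0\<^sub>m m 1) (- U * (E * V) + C)"
    unfolding lo_def A_eq using car
    by (subst mult_four_block_mat[of _ 1 1 _ m _ m _ _ 1 _ n]) auto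
  moreover have "E * - V + E * V = 0\<^sub>m 1 n" using car by (auto intro!: eq_matI)
  ultimately have "lo (- U) * A * up (- V) = four_block_mat E (0\<^sub>m 1 n) (0\<^sub>m m 1) (- U * (E * V) + C)"
    unfolding up_def using car
    by (simp, subst mult_four_block_mat[of _ 1 1 _ n _ m _ _ 1 _ n]) auto
  moreover have "- U * (E * V) + C \<in> carrier_mat m n" using car by simp
  moreover have "- U \<in> carrier_mat m 1" "- V \<in> carrier_mat 1 n" using car by simp_all
  ultimately show thesis using that[OF lo_car P up_car Q] unfolding E_def by blast
qed

text \<open>Induction on the number of rows: an entry dividing all others is swapped into the
  corner, its row and column are cleared, and the smaller block is treated recursively.\<close>

lemma smith_normal_form_exists:
  fixes A :: "'a::comm_ring_1 mat"
  assumes tot: "\<And>x y :: 'a. x dvd y \<or> y dvd x"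
  assumes "A \<in> carrier_mat m n"
  shows "\<exists>P Q. P \<in> carrier_mat m m \<and> invertible_mat P \<and> Q \<in> carrier_mat n n \<and> invertible_mat Q \<and>
    is_snf (P * A * Q)"
  using assms(2)
proof (induction m arbitrary: n A)
  case 0
  then show ?case
    by - (rule exI[of _ "1\<^sub>m 0"], rule exI[of _ "1\<^sub>m n"], auto simp: is_snf_def invertible_one_mat)
next
  case (Suc m)
  show ?case
  proof (cases n)
    case 0
    with Suc.prems show ?thesis
      by - (rule exI[of _ "1\<^sub>m (Suc m)"], rule exI[of _ "1\<^sub>m 0"], auto simp: is_snf_def invertible_one_mat)
  next
    case (Suc n')
    note A = Suc.prems[unfolded Suc]
    obtain p q where pq: "p < Suc m" "q < Suc n'"
      and piv: "\<And>i j. i < Suc m \<Longrightarrow> j < Suc n' \<Longrightarrow> A $$ (p, q) dvd A $$ (i, j)"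
      using ex_entry_dvd_all[OF tot] by metis
    define P1 :: "'a mat" where "P1 = swaprows_mat (Suc m) 0 p"
    define Q1 :: "'a mat" where "Q1 = swaprows_mat (Suc n') 0 q"
    have P1: "P1 \<in> carrier_mat (Suc m) (Suc m)" "invertible_mat P1"
      using pq by (auto simp: P1_def invertible_swaprows_mat)
    have Q1: "Q1 \<in> carrier_mat (Suc n') (Suc n')" "invertible_mat Q1"
      using pq by (auto simp: Q1_def invertible_swaprows_mat)
    have PA: "P1 * A = swaprows 0 p A"
      using swaprows_mat[OF A, of 0 p] pq by (simp add: P1_def)
    have PAQ: "P1 * A * Q1 = swapcols 0 q (P1 * A)"
      using swapcols_mat[of "P1 * A" "Suc m" "Suc n'" 0 q] pq P1 A by (simp add: Q1_def)
    define A1 where "A1 = P1 * A * Q1"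
    define d where "d = A $$ (p, q)"
    have A1: "A1 \<in> carrier_mat (Suc m) (Suc n')" using P1 Q1 A by (auto simp: A1_def)
    have A100: "A1 $$ (0, 0) = d"
      unfolding A1_def PAQ unfolding PA d_def using A pq by simp
    have d_A1: "A1 $$ (0, 0) dvd A1 $$ (i, j)" if "i < Suc m" "j < Suc n'" for i j
      unfolding A100 unfolding A1_def d_def by (rule dvd_mult_mat[OF P1(1) A Q1(1) piv that])
    obtain P2 Q2 B where P2: "P2 \<in> carrier_mat (Suc m) (Suc m)" "invertible_mat P2"
      and Q2: "Q2 \<in> carrier_mat (Suc n') (Suc n')" "invertible_mat Q2" and B: "B \<in> carrier_mat m n'"
      and blk: "P2 * A1 * Q2 = four_block_mat (mat 1 1 (\<lambda>_. d)) (0\<^sub>m 1 n') (0\<^sub>m m 1) B"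
      using block_elimination[OF A1 d_A1] unfolding A100 by metis
    have d_B: "d dvd B $$ (i, j)" if "i < m" "j < n'" for i j
      using dvd_mult_mat[OF P2(1) A1 Q2(1) d_A1, of "Suc i" "Suc j"] that B
      unfolding blk A100 by simp
    obtain P3 Q3 where P3: "P3 \<in> carrier_mat m m" "invertible_mat P3"
      and Q3: "Q3 \<in> carrier_mat n' n'" "invertible_mat Q3" and snf: "is_snf (P3 * B * Q3)"
      using Suc.IH[OF B] by blast
    \<comment> \<open>Padding by a 1 in the corner lets a transformation of the smaller block act
      without touching the pivot.\<close>
    define ext where "ext = (\<lambda>k (X :: 'a mat). four_block_mat (1\<^sub>m 1) (0\<^sub>m 1 k) (0\<^sub>m k 1) X)"
    have ext_car: "ext k X \<in> carrier_mat (Suc k) (Suc k)" if "X \<in> carrier_mat k k" for k X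
      using that four_block_carrier_mat[of "1\<^sub>m 1" 1 1 X k k] by (simp add: ext_def)
    have ext_mult: "ext k X * ext k Y = ext k (X * Y)"
      if "X \<in> carrier_mat k k" "Y \<in> carrier_mat k k" for k X Y
      unfolding ext_def using that
      by (subst mult_four_block_mat[of _ 1 1 _ k _ k _ _ 1 _ k]) auto
    have ext_one: "ext k (1\<^sub>m k) = 1\<^sub>m (Suc k)" for k
      using four_block_one_mat[of 1 k] by (simp add: ext_def)
    have ext_inv: "invertible_mat (ext k X)" if X: "X \<in> carrier_mat k k" "invertible_mat X" for k X
    proof -
      obtain Y where "Y \<in> carrier_mat k k" "X * Y = 1\<^sub>m k" "Y * X = 1\<^sub>m k"
        using X invertible_matE by blast
      with X show ?thesis
        by (intro invertible_matI[of _ "Suc k" "ext k Y"]) (auto simp: ext_mult ext_one ext_car)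
    qed
    define P where "P = ext m P3 * (P2 * P1)"
    define Q where "Q = Q1 * (Q2 * ext n' Q3)"
    define B' where "B' = P3 * B * Q3"
    have B': "B' \<in> carrier_mat m n'" using P3 Q3 B by (auto simp: B'_def)
    have "P * A * Q = ext m P3 * (P2 * A1 * Q2) * ext n' Q3"
      unfolding P_def Q_def A1_def using P1 Q1 P2 Q2 A ext_car[OF P3(1)] ext_car[OF Q3(1)]
      by (simp add: assoc_mult_mat[of _ "Suc m" "Suc m" _ "Suc n'" _ "Suc n'"]
          assoc_mult_mat[of _ "Suc m" "Suc m" _ "Suc m" _ "Suc n'"]
          assoc_mult_mat[of _ "Suc m" "Suc n'" _ "Suc n'" _ "Suc n'"]
          assoc_mult_mat[of _ "Suc n'" "Suc n'" _ "Suc n'" _ "Suc n'"]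
          assoc_mult_mat[of _ "Suc m" "Suc m" _ "Suc m" _ "Suc m"])
    also have "ext m P3 * (P2 * A1 * Q2) =
        four_block_mat (mat 1 1 (\<lambda>_. d)) (0\<^sub>m 1 n') (0\<^sub>m m 1) (P3 * B)"
      unfolding blk ext_def using P3 B
      by (subst mult_four_block_mat[of _ 1 1 _ m _ m _ _ 1 _ n']) auto
    also have "\<dots> * ext n' Q3 = four_block_mat (mat 1 1 (\<lambda>_. d)) (0\<^sub>m 1 n') (0\<^sub>m m 1) B'"
      unfolding ext_def B'_def using P3 B Q3
      by (subst mult_four_block_mat[of _ 1 1 _ n' _ m _ _ 1 _ n']) auto
    finally have eq: "P * A * Q = four_block_mat (mat 1 1 (\<lambda>_. d)) (0\<^sub>m 1 n') (0\<^sub>m m 1) B'" .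
    have d_B': "d dvd B' $$ (i, j)" if "i < m" "j < n'" for i j
      unfolding B'_def by (rule dvd_mult_mat[OF P3(1) B Q3(1) d_B that])
    have snf': "\<And>i j. i < m \<Longrightarrow> j < n' \<Longrightarrow> i \<noteq> j \<Longrightarrow> B' $$ (i, j) = 0"
      "\<And>i. Suc i < m \<Longrightarrow> Suc i < n' \<Longrightarrow> B' $$ (i, i) dvd B' $$ (Suc i, Suc i)"
      using snf B' unfolding B'_def[symmetric] is_snf_def by auto
    have "(P * A * Q) $$ (i, j) = 0" if "i < Suc m" "j < Suc n'" "i \<noteq> j" for i j
      using that B' snf'(1)[of "i - 1" "j - 1"] unfolding eq by (cases i; cases j) auto
    \<comment> \<open>For \<open>i = 0\<close> the pivot \<open>d\<close> divides the whole block
      \<open>B'\<close>; later divisibilities come from the recursion.\<close>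
    moreover have "(P * A * Q) $$ (i, i) dvd (P * A * Q) $$ (Suc i, Suc i)"
      if "Suc i < Suc m" "Suc i < Suc n'" for i
      using that B' snf'(2)[of "i - 1"] d_B' unfolding eq by (cases i) auto
    moreover have "dim_row (P * A * Q) = Suc m" "dim_col (P * A * Q) = Suc n'"
      using B' unfolding eq by auto
    ultimately have "is_snf (P * A * Q)" unfolding is_snf_def by auto
    moreover have "P \<in> carrier_mat (Suc m) (Suc m)" "Q \<in> carrier_mat (Suc n') (Suc n')"
      using P1 P2 Q1 Q2 ext_car[OF P3(1)] ext_car[OF Q3(1)] by (auto simp: P_def Q_def)
    moreover have "invertible_mat P" "invertible_mat Q"
      unfolding P_def Q_def
      by (intro invertible_mat_mult[of _ "Suc m"] invertible_mat_mult[of _ "Suc n'"] ext_inv P1 P2 P3 Q1 Q2 Q3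
          ext_car mult_carrier_mat[of _ "Suc m" "Suc m"] mult_carrier_mat[of _ "Suc n'" "Suc n'"])+
    ultimately show ?thesis using Suc by blast
  qed
qed

text \<open>An invertible \<open>P\<close> neither creates nor destroys zero columns, so the nonzero
  diagonal entries can be counted on \<open>A * Q\<close>. A relation \<open>x\<close> between its
  columns becomes \<open>D $$ (j, j) * x j = 0\<close> after multiplication by \<open>P\<close>,
  which rules out a unit \<open>x j\<close> when the diagonal entry is nonzero.\<close>

lemma snf_rank_witness:
  fixes A :: "'a::comm_ring_1 mat"
  assumes tot: "\<And>x y :: 'a. x dvd y \<or> y dvd x" and A: "A \<in> carrier_mat m n"
  obtains Q Q' where "Q \<in> carrier_mat n n" "Q' \<in> carrier_mat n n" "Q * Q' = 1\<^sub>m n" "Q' * Q = 1\<^sub>m n"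
    "snf_rank A = card {j. j < n \<and> (\<exists>i<m. (A * Q) $$ (i, j) \<noteq> 0)}"
    "\<forall>x j. (\<forall>i<m. (\<Sum>j<n. (A * Q) $$ (i, j) * x j) = 0) \<longrightarrow> j < n \<longrightarrow>
       (\<exists>i<m. (A * Q) $$ (i, j) \<noteq> 0) \<longrightarrow> \<not> x j dvd 1"
proof -
  let ?S = "\<lambda>r. \<exists>P Q D.
     P \<in> carrier_mat (dim_row A) (dim_row A) \<and> invertible_mat P \<and>
     Q \<in> carrier_mat (dim_col A) (dim_col A) \<and> invertible_mat Q \<and>
     D = P * A * Q \<and>
     (\<forall>i j. i < dim_row A \<longrightarrow> j < dim_col A \<longrightarrow> i \<noteq> j \<longrightarrow> D $$ (i, j) = 0) \<and>
     (\<forall>i. Suc i < min (dim_row A) (dim_col A) \<longrightarrow> D $$ (i, i) dvd D $$ (Suc i, Suc i)) \<and>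
     r = card {i. i < min (dim_row A) (dim_col A) \<and> D $$ (i, i) \<noteq> 0}"
  obtain P0 Q0 where "P0 \<in> carrier_mat m m" "invertible_mat P0" "Q0 \<in> carrier_mat n n" "invertible_mat Q0"
    "is_snf (P0 * A * Q0)"
    using smith_normal_form_exists[OF tot A] by blast
  with A have "?S (card {i. i < min m n \<and> (P0 * A * Q0) $$ (i, i) \<noteq> 0})"
    unfolding is_snf_def by - (rule exI[of _ P0], rule exI[of _ Q0], auto)
  \<comment> \<open>The form just constructed only shows that the choice is meaningful; from here on
    \<open>P\<close>, \<open>Q\<close> and \<open>D\<close> belong to the selected form.\<close>
  then have "?S (snf_rank A)" unfolding snf_rank_def by (rule someI[of ?S])
  with A obtain P Q D where P: "P \<in> carrier_mat m m" "invertible_mat P"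
    and Q: "Q \<in> carrier_mat n n" "invertible_mat Q" and D: "D = P * A * Q"
    and diag: "\<And>i j. i < m \<Longrightarrow> j < n \<Longrightarrow> i \<noteq> j \<Longrightarrow> D $$ (i, j) = 0"
    and r: "snf_rank A = card {i. i < min m n \<and> D $$ (i, i) \<noteq> 0}"
    by auto
  obtain P' where P': "P' \<in> carrier_mat m m" "P' * P = 1\<^sub>m m" using P invertible_matE by blast
  obtain Q' where Q': "Q' \<in> carrier_mat n n" "Q * Q' = 1\<^sub>m n" "Q' * Q = 1\<^sub>m n"
    using Q invertible_matE by blast
  define V where "V = A * Q"
  have V: "V \<in> carrier_mat m n" using A Q by (simp add: V_def)
  have DV: "D = P * V" using A P Q by (simp add: D V_def)
  have "P' * D = (P' * P) * V" unfolding DV using assoc_mult_mat[OF P'(1) P(1) V] by simp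
  then have VD: "V = P' * D" using P' V by simp
  have D_car: "D \<in> carrier_mat m n" using DV P V by simp
  have Dij: "D $$ (i, j) = (\<Sum>l<m. P $$ (i, l) * V $$ (l, j))" if "i < m" "j < n" for i j
    using that P V by (simp add: DV scalar_prod_def atLeast0LessThan)
  have Vij: "V $$ (i, j) = (\<Sum>l<m. P' $$ (i, l) * D $$ (l, j))" if "i < m" "j < n" for i j
    using that P' D_car by (subst VD) (simp add: scalar_prod_def atLeast0LessThan)
  \<comment> \<open>\<open>V = P' * D\<close> and \<open>D\<close> is diagonal: column
    \<open>j\<close> of \<open>V\<close> can be nonzero only if \<open>j\<close> indexes a nonzero
    diagonal entry.\<close>
  have V_nz: "j < m" "D $$ (j, j) \<noteq> 0" if ij: "i < m" "j < n" "V $$ (i, j) \<noteq> 0" for i j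
  proof -
    obtain l where "l < m" "D $$ (l, j) \<noteq> 0"
      using ij Vij[of i j] by (metis (no_types, lifting) lessThan_iff mult_zero_right sum.neutral)
    with diag[of l j] ij show "j < m" "D $$ (j, j) \<noteq> 0" by auto
  qed
  have D_nz: "\<exists>i<m. V $$ (i, j) \<noteq> 0" if "j < n" "j < m" "D $$ (j, j) \<noteq> 0" for j
    using that Dij[of j j] by (metis (no_types, lifting) lessThan_iff mult_zero_right sum.neutral)
  have rank: "{i. i < min m n \<and> D $$ (i, i) \<noteq> 0} = {j. j < n \<and> (\<exists>i<m. V $$ (i, j) \<noteq> 0)}"
    using V_nz D_nz by auto
  have nonunit: "\<not> x j dvd 1"
    if x: "\<And>i. i < m \<Longrightarrow> (\<Sum>j<n. V $$ (i, j) * x j) = 0" and j: "j < n" "i < m" "V $$ (i, j) \<noteq> 0" for x i j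
  proof
    assume "x j dvd 1"
    have jm: "j < m" "D $$ (j, j) \<noteq> 0" using V_nz j by auto
    have "(\<Sum>p<n. D $$ (j, p) * x p) = (\<Sum>p<n. \<Sum>l<m. P $$ (j, l) * (V $$ (l, p) * x p))"
      using jm by (intro sum.cong) (auto simp: Dij sum_distrib_right mult.assoc)
    also have "\<dots> = (\<Sum>l<m. P $$ (j, l) * (\<Sum>p<n. V $$ (l, p) * x p))"
      by (subst sum.swap) (simp add: sum_distrib_left)
    also have "\<dots> = 0" using x by simp
    also have "(\<Sum>p<n. D $$ (j, p) * x p) = (\<Sum>p<n. if p = j then D $$ (j, j) * x j else 0)"
      using jm diag by (intro sum.cong) auto
    finally have "D $$ (j, j) * x j = 0" using j by simp
    with \<open>x j dvd 1\<close> have "D $$ (j, j) = 0" by (metis dvd_def mult.assoc mult.right_neutral mult_zero_left)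
    with jm show False by simp
  qed
  show thesis
  proof (rule that[OF Q(1) Q'])
    show "snf_rank A = card {j. j < n \<and> (\<exists>i<m. (A * Q) $$ (i, j) \<noteq> 0)}"
      using r unfolding rank V_def .
    show "\<forall>x j. (\<forall>i<m. (\<Sum>j<n. (A * Q) $$ (i, j) * x j) = 0) \<longrightarrow> j < n \<longrightarrow>
       (\<exists>i<m. (A * Q) $$ (i, j) \<noteq> 0) \<longrightarrow> \<not> x j dvd 1"
      using nonunit unfolding V_def by blast
  qed
qed

section \<open>Finite chain rings\<close>

lemma chain_ring_dvd_total:
  assumes "chain_ring TYPE('a::comm_ring_1)"
  shows "x dvd y \<or> y dvd (x :: 'a)"
proof -
  have "is_ideal {z. w dvd z}" for w :: 'a
    unfolding is_ideal_def by auto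
  moreover have "I \<subseteq> J \<or> J \<subseteq> I" if "is_ideal I" "is_ideal J" for I J :: "'a set"
    using assms that unfolding chain_ring_def by simp
  ultimately have "{z. x dvd z} \<subseteq> {z. y dvd z} \<or> {z. y dvd z} \<subseteq> {z. x dvd z}"
    by simp
  moreover have "x \<in> {z. x dvd z}" "y \<in> {z. y dvd z}" by simp_all
  ultimately show ?thesis by (metis mem_Collect_eq subsetD)
qed

text \<open>Of two non-units one divides the other and hence their sum, so the non-units form an
  ideal. It contains every proper ideal, which makes the definite description well defined.\<close>

lemma max_ideal_eq_nonunits:
  assumes chain: "chain_ring TYPE('a::comm_ring_1)"
  shows "max_ideal = {x :: 'a. \<not> x dvd 1}"
proof -
  let ?N = "{x :: 'a. \<not> x dvd 1}"
  have "x + y \<in> ?N" if "x \<in> ?N" "y \<in> ?N" for x y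
  proof -
    have "x dvd x + y \<or> y dvd x + y"
      using chain_ring_dvd_total[OF chain, of x y] by auto
    with that show ?thesis using dvd_trans by blast
  qed
  moreover have "(0 :: 'a) \<in> ?N" using chain unfolding chain_ring_def by simp
  moreover have "r * x \<in> ?N" if "x \<in> ?N" for r x
    using that dvd_mult_right by blast
  ultimately have N: "is_ideal ?N" unfolding is_ideal_def by simp
  have sub: "I \<subseteq> ?N" if "is_ideal I" "I \<noteq> UNIV" for I
  proof
    fix x assume "x \<in> I"
    show "x \<in> ?N"
    proof (rule ccontr)
      assume "x \<notin> ?N"
      then obtain y where "1 = x * y" by auto
      then have "r = (r * y) * x" for r by (metis mult.assoc mult.commute mult.left_neutral)
      then have "r \<in> I" for r
        using \<open>is_ideal I\<close> \<open>x \<in> I\<close> unfolding is_ideal_def by metis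
      then have "I = UNIV" by auto
      with \<open>I \<noteq> UNIV\<close> show False by simp
    qed
  qed
  have NU: "?N \<noteq> UNIV" using dvd_refl by blast
  have "maximal_ideal ?N" unfolding maximal_ideal_def
    using N NU sub by (meson subset_antisym)
  moreover have "I = ?N" if "maximal_ideal I" for I
  proof -
    have I: "is_ideal I" "I \<noteq> UNIV" and max: "\<And>J. is_ideal J \<Longrightarrow> I \<subseteq> J \<Longrightarrow> J = I \<or> J = UNIV"
      using that unfolding maximal_ideal_def by auto
    show ?thesis using max[OF N sub[OF I]] NU by simp
  qed
  ultimately show ?thesis unfolding max_ideal_def by (rule the_equality)
qed

text \<open>In the finite set of non-units some element divides all others; it is 0 when the ring is
  a field.\<close>

lemma chain_ring_uniformizer:
  assumes chain: "chain_ring TYPE('a::{comm_ring_1,finite})"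
  shows "\<exists>p :: 'a. \<forall>x. \<not> x dvd 1 \<longleftrightarrow> p dvd x"
proof -
  have "\<exists>x\<in>X. \<forall>y\<in>X. x dvd y" if "X \<noteq> {}" for X :: "'a set"
    using ex_dvd_all[OF chain_ring_dvd_total[OF chain] finite that] .
  moreover have "0 \<in> {x :: 'a. \<not> x dvd 1}" using chain unfolding chain_ring_def by simp
  ultimately obtain p :: 'a where p: "\<not> p dvd 1" "\<And>y. \<not> y dvd 1 \<Longrightarrow> p dvd y"
    by (metis (mono_tags, lifting) empty_iff mem_Collect_eq)
  then show ?thesis using dvd_trans by blast
qed

text \<open>\<open>e\<close> and \<open>1 - e\<close> annihilate each other, so the one that is a
  multiple of the other squares to zero and, being idempotent, is zero.\<close>

lemma chain_ring_idempotent: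
  assumes chain: "chain_ring TYPE('a::comm_ring_1)" and e: "e * e = (e :: 'a)"
  shows "e = 0 \<or> e = 1"
  using chain_ring_dvd_total[OF chain, of e "1 - e"]
proof
  assume "e dvd 1 - e"
  then obtain y where y: "1 - e = e * y" by auto
  have "e * (1 - e) = 0" using e by (simp add: algebra_simps)
  then have "e * y = 0" using e y by (metis mult.assoc)
  with y show ?thesis by simp
next
  assume "1 - e dvd e"
  then obtain y where y: "e = (1 - e) * y" by auto
  have "e * (1 - e) = 0" using e by (simp add: algebra_simps)
  then have "e * e = 0" using y by (metis mult.assoc mult_zero_left)
  with e show ?thesis by simp
qed

lemma finite_ring_power_idempotent:
  fixes x :: "'a::comm_ring_1"
  assumes "finite (UNIV :: 'a set)"
  shows "\<exists>N>0. x ^ N * x ^ N = x ^ N"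
proof -
  have "\<not> inj (\<lambda>n :: nat. x ^ n)"
    using assms finite_imageD infinite_UNIV_nat by (metis finite_subset subset_UNIV)
  then obtain i j where "i < j" "x ^ i = x ^ j"
    unfolding inj_def by (metis linorder_neqE_nat)
  then obtain d where d: "d > 0" "x ^ i = x ^ (i + d)"
    by (metis less_imp_add_positive)
  have shift: "x ^ (n + d) = x ^ n" if n: "n \<ge> i" for n
  proof -
    obtain c where "n = i + c" using le_Suc_ex[OF n] by metis
    then have "x ^ (n + d) = x ^ (i + d) * x ^ c" by (simp add: power_add mult_ac)
    also have "\<dots> = x ^ i * x ^ c" using d by simp
    finally show ?thesis using \<open>n = i + c\<close> by (simp add: power_add)
  qed
  have "x ^ (n + c * d) = x ^ n" if "n \<ge> i" for n c
  proof (induction c)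
    case (Suc c)
    have "x ^ (n + Suc c * d) = x ^ ((n + c * d) + d)" by (simp add: algebra_simps)
    then show ?case using Suc shift[of "n + c * d"] that by simp
  qed simp
  \<comment> \<open>The powers have period \<open>d\<close> from exponent \<open>i\<close> on.
    \<open>Suc i * d\<close> is a positive multiple of the period that is at least \<open>i\<close>,
    so doubling this exponent changes nothing.\<close>
  from this[of "Suc i * d" "Suc i"] have "x ^ (Suc i * d + Suc i * d) = x ^ (Suc i * d)"
    using d(1) by (cases d) auto
  then show ?thesis using d(1) by (intro exI[of _ "Suc i * d"]) (simp add: power_add)
qed

text \<open>The usual root bound survives zero divisors when distinct candidates differ by units:
  after splitting off a root \<open>x\<close>, the factor \<open>y - x\<close> can be cancelled from
  the congruence at \<open>y\<close>.\<close>

lemma card_roots_mod_le: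
  fixes f :: "'a::comm_ring_1 poly"
  assumes "\<not> p dvd 1" "finite X" "coeff f d = 1" "degree f \<le> d"
    and "\<And>x. x \<in> X \<Longrightarrow> p dvd poly f x"
    and "\<And>x y. x \<in> X \<Longrightarrow> y \<in> X \<Longrightarrow> x \<noteq> y \<Longrightarrow> (x - y) dvd 1"
  shows "card X \<le> d"
  using assms(2-)
proof (induction d arbitrary: f X)
  case 0
  then have "f = [:1:]" by (metis le_zero_eq degree_0_id)
  with 0 \<open>\<not> p dvd 1\<close> have "X = {}" by auto
  then show ?case by simp
next
  case (Suc d)
  show ?case
  proof (cases "X = {}")
    case False
    then obtain x where x: "x \<in> X" by blast
    define g where "g = synthetic_div f x"
    have f: "f = [:- x, 1:] * g + [:poly f x:]"
      unfolding g_def by (rule synthetic_div_correct'[symmetric])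
    have deg: "degree g \<le> d" using Suc.prems(3) by (simp add: g_def degree_synthetic_div)
    have "coeff f (Suc d) = coeff g d"
      by (subst f) (use deg in \<open>simp add: coeff_eq_0\<close>)
    with Suc.prems have "coeff g d = 1" by simp
    moreover have "p dvd poly g y" if y: "y \<in> X - {x}" for y
    proof -
      have "poly f y = (y - x) * poly g y + poly f x"
        by (subst f) (simp add: algebra_simps)
      then have "p dvd (y - x) * poly g y"
        using Suc.prems(4)[OF x] Suc.prems(4)[of y] y by (metis DiffD1 dvd_add_left_iff)
      moreover obtain z where "1 = (y - x) * z" using Suc.prems(5)[of y x] x y by auto
      then have "poly g y = ((y - x) * poly g y) * z"
        by (metis mult.assoc mult.commute mult.right_neutral)
      ultimately show ?thesis by (metis dvd_mult2)
    qed
    ultimately have "card (X - {x}) \<le> d"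
      using Suc.IH[of "X - {x}" g] Suc.prems deg by auto
    then show ?thesis using x Suc.prems(1) by simp
  qed simp
qed

section \<open>Unramified extensions\<close>

text \<open>The base ring enters through an embedding. Coordinate functions are forced to vanish
  from \<open>m\<close> on, so that a basis is the same as a bijection onto the extension.\<close>

locale chain_ring_extension =
  fixes \<iota> :: "'r::{comm_ring_1,finite} \<Rightarrow> 's::comm_ring_1"
    and \<sigma> :: "'s \<Rightarrow> 's" and b :: "nat \<Rightarrow> 's" and m :: nat
  assumes chain: "chain_ring TYPE('r)"
    and \<iota>_hom: "is_ring_hom \<iota>" and \<iota>_inj: "inj \<iota>"
    and basis: "bij_betw (\<lambda>c. \<Sum>i<m. \<iota> (c i) * b i) {c. \<forall>i\<ge>m. c i = 0} UNIV"
    and \<sigma>_aut: "is_ring_aut \<sigma>"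
    and \<sigma>_fix: "{y. \<sigma> y = y} = range \<iota>"
    and \<sigma>_frob: "\<sigma> y - y ^ residue_card (max_ideal :: 'r set) \<in> ext_ideal \<iota> max_ideal"
begin

section \<open>Computation rules for the embedding and the automorphism\<close>

lemma \<iota>_1 [simp]: "\<iota> 1 = 1" and \<iota>_add: "\<iota> (x + y) = \<iota> x + \<iota> y" and \<iota>_mult: "\<iota> (x * y) = \<iota> x * \<iota> y"
  using \<iota>_hom unfolding is_ring_hom_def by auto

lemma \<iota>_0 [simp]: "\<iota> 0 = 0"
  using \<iota>_add[of 0 0] by simp

lemma \<iota>_minus: "\<iota> (- x) = - \<iota> x"
  using \<iota>_add[of x "- x"] by (simp add: eq_neg_iff_add_eq_0 add.commute)

lemma \<iota>_diff: "\<iota> (x - y) = \<iota> x - \<iota> y"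
  using \<iota>_add[of x "- y"] by (simp add: \<iota>_minus)

lemma \<iota>_sum: "\<iota> (sum f X) = (\<Sum>x\<in>X. \<iota> (f x))"
  by (induction X rule: infinite_finite_induct) (auto simp: \<iota>_add)

lemma \<iota>_power: "\<iota> (x ^ n) = \<iota> x ^ n"
  by (induction n) (auto simp: \<iota>_mult)

lemma \<iota>_eq_0_iff [simp]: "\<iota> x = 0 \<longleftrightarrow> x = 0"
  using \<iota>_inj \<iota>_0 by (metis injD)

lemma \<sigma>_1 [simp]: "\<sigma> 1 = 1" and \<sigma>_add: "\<sigma> (x + y) = \<sigma> x + \<sigma> y" and \<sigma>_mult: "\<sigma> (x * y) = \<sigma> x * \<sigma> y"
  and bij_\<sigma>: "bij \<sigma>"
  using \<sigma>_aut unfolding is_ring_aut_def is_ring_hom_def by auto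

lemma \<sigma>_0 [simp]: "\<sigma> 0 = 0"
  using \<sigma>_add[of 0 0] by simp

lemma \<sigma>_sum: "\<sigma> (sum f X) = (\<Sum>x\<in>X. \<sigma> (f x))"
  by (induction X rule: infinite_finite_induct) (auto simp: \<sigma>_add)

lemma \<sigma>_\<iota> [simp]: "\<sigma> (\<iota> r) = \<iota> r"
  using \<sigma>_fix by auto

lemma \<sigma>_unit: "x dvd 1 \<Longrightarrow> \<sigma> x dvd 1"
  by (metis \<sigma>_1 \<sigma>_mult dvd_def)

section \<open>The uniformizer and the units of the extension\<close>

lemma zero_neq_one_S: "(0 :: 's) \<noteq> 1"
proof -
  have "(0 :: 'r) \<noteq> 1" using chain unfolding chain_ring_def by simp
  then show ?thesis using \<iota>_eq_0_iff[of 1] by simp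
qed

lemma finite_S: "finite (UNIV :: 's set)"
proof -
  have "finite {c :: nat \<Rightarrow> 'r. \<forall>i. (i \<in> {..<m} \<longrightarrow> c i \<in> UNIV) \<and> (i \<notin> {..<m} \<longrightarrow> c i = 0)}"
    by (rule finite_set_of_finite_funs) auto
  then have "finite {c :: nat \<Rightarrow> 'r. \<forall>i\<ge>m. c i = 0}"
    by (simp add: not_less)
  then show ?thesis using basis bij_betw_finite by blast
qed

definition \<pi> :: 'r where
  "\<pi> = (SOME p. \<forall>x. \<not> x dvd 1 \<longleftrightarrow> p dvd x)"

text \<open>The maximal ideal of the extension is generated by the image of the uniformizer, so that
  membership in it is expressed as divisibility by \<open>p\<close>.\<close>

abbreviation p :: 's where "p \<equiv> \<iota> \<pi>"

lemma unit_R_iff: "x dvd 1 \<longleftrightarrow> \<not> \<pi> dvd x"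
  using someI_ex[OF chain_ring_uniformizer[OF chain]] unfolding \<pi>_def by blast

lemma max_ideal_R: "(max_ideal :: 'r set) = {x. \<pi> dvd x}"
  using max_ideal_eq_nonunits[OF chain] unit_R_iff by auto

lemma p_dvd_\<iota>: "\<pi> dvd r \<Longrightarrow> p dvd \<iota> r"
  by (auto simp: dvd_def \<iota>_mult)

lemma ext_ideal_dvd: "x \<in> ext_ideal \<iota> max_ideal \<Longrightarrow> p dvd x"
  unfolding ext_ideal_def max_ideal_R
  by (auto intro!: dvd_sum dvd_mult2 p_dvd_\<iota>)

lemma frob: "p dvd \<sigma> y - y ^ residue_card (max_ideal :: 'r set)"
  using \<sigma>_frob ext_ideal_dvd by blast

text \<open>By finiteness a positive power of \<open>\<pi>\<close> is idempotent, hence 0 or 1, and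
  1 would make \<open>\<pi>\<close> a unit.\<close>

lemma \<pi>_nilpotent: "\<exists>N. \<pi> ^ N = 0"
proof -
  obtain N where N: "N > 0" "\<pi> ^ N * \<pi> ^ N = \<pi> ^ N"
    using finite_ring_power_idempotent[of \<pi>] by auto
  have "\<pi> ^ N \<noteq> 1"
  proof
    assume "\<pi> ^ N = 1"
    then have "\<pi> dvd 1" using dvd_power[of N \<pi>] N(1) by simp
    then show False using unit_R_iff[of \<pi>] by simp
  qed
  then show ?thesis using chain_ring_idempotent[OF chain N(2)] by blast
qed

lemma p_nilpotent: "\<exists>N. p ^ N = 0"
  using \<pi>_nilpotent by (metis \<iota>_power \<iota>_eq_0_iff)

lemma p_not_unit: "\<not> p dvd 1"
proof
  assume "p dvd 1"
  then have "p ^ N dvd 1" for N using dvd_power_same[of p 1 N] by simp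
  with p_nilpotent zero_neq_one_S show False by (metis dvd_0_left)
qed

lemma p_dvd_\<sigma>_iff: "p dvd \<sigma> x \<longleftrightarrow> p dvd x"
proof
  assume "p dvd \<sigma> x"
  then obtain y where y: "\<sigma> x = p * y" by auto
  obtain z where "y = \<sigma> z" using bij_\<sigma> by (metis bij_pointE)
  with y have "\<sigma> x = \<sigma> (p * z)" by (simp add: \<sigma>_mult)
  then have "x = p * z" using bij_\<sigma> by (metis bij_is_inj injD)
  then show "p dvd x" by simp
qed (auto simp: dvd_def \<sigma>_mult)

lemma p_dvd_diff_power:
  assumes "p dvd x - y"
  shows "p dvd x ^ n - y ^ n"
proof (induction n)
  case (Suc n)
  have "x ^ Suc n - y ^ Suc n = x * (x ^ n - y ^ n) + (x - y) * y ^ n"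
    by (simp add: algebra_simps)
  then show ?case using Suc assms by simp
qed simp

lemma residue_card_gt_1: "residue_card (max_ideal :: 'r set) > 1"
proof -
  let ?cl = "\<lambda>r. {r' :: 'r. r - r' \<in> max_ideal}"
  have "0 \<in> ?cl 0" "0 \<notin> ?cl 1"
    using unit_R_iff[of 1] by (auto simp: max_ideal_R)
  then have "?cl 0 \<noteq> ?cl 1" by blast
  then have "card {?cl 0, ?cl 1} = 2" by simp
  moreover have "card {?cl 0, ?cl 1} \<le> card (range ?cl)"
    by (rule card_mono[OF finite]) blast
  ultimately show ?thesis unfolding residue_card_def by linarith
qed

text \<open>The residue ring is reduced because the Frobenius lifts to the automorphism, and it has no
  nontrivial idempotents because idempotents modulo a nil ideal lift uniquely, hence are fixed by
  the automorphism and lie in the local ring below. A finite ring with these two properties is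
  a field.\<close>

lemma unit_S_iff: "x dvd 1 \<longleftrightarrow> \<not> p dvd x"
proof
  assume "x dvd 1"
  then show "\<not> p dvd x" using p_not_unit dvd_trans by blast
next
  assume nd: "\<not> p dvd x"
  let ?q = "residue_card (max_ideal :: 'r set)"
  obtain N where N: "N > 0" "x ^ N * x ^ N = x ^ N"
    using finite_ring_power_idempotent[OF finite_S] by blast
  define e where "e = x ^ N"
  define d where "d = \<sigma> e - e"
  have e: "e * e = e" using N by (simp add: e_def)
  have e': "\<sigma> e * \<sigma> e = \<sigma> e" using e by (metis \<sigma>_mult)
  have "e ^ Suc n = e" for n by (induction n) (auto simp: e)
  then have "e ^ ?q = e" using residue_card_gt_1 by (metis Suc_lessD gr0_implies_Suc zero_less_Suc One_nat_def)
  then have pd: "p dvd d" using frob[of e] by (simp add: d_def)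
  \<comment> \<open>This holds for the difference of any two commuting idempotents.\<close>
  have d3: "d ^ 3 = d"
  proof -
    have "d ^ 3 = \<sigma> e * \<sigma> e * \<sigma> e - 3 * (\<sigma> e * \<sigma> e) * e + 3 * \<sigma> e * (e * e) - e * e * e"
      unfolding d_def by (simp add: power3_eq_cube algebra_simps)
    then show ?thesis unfolding e e' by (simp add: d_def)
  qed
  \<comment> \<open>If \<open>p ^ n\<close> and \<open>p\<close> divide \<open>d\<close>, then
    \<open>p ^ Suc n\<close> divides \<open>d * d\<close> and so \<open>d ^ 3 = d\<close>.
    Nilpotency of \<open>p\<close> then leaves only \<open>d = 0\<close>.\<close>
  have "p ^ n dvd d" for n
  proof (induction n)
    case (Suc n)
    have "p ^ Suc n dvd d * d" using Suc pd by (simp add: mult_dvd_mono)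
    then have "p ^ Suc n dvd d ^ 3" by (simp add: power3_eq_cube dvd_mult2)
    then show ?case using d3 by simp
  qed simp
  then have "d = 0" using p_nilpotent by (metis dvd_0_left)
  then have "e \<in> range \<iota>" using \<sigma>_fix unfolding d_def by auto
  then obtain r where r: "e = \<iota> r" by blast
  then have "r * r = r" using e \<iota>_inj by (metis \<iota>_mult injD)
  then have "r = 0 \<or> r = 1" by (rule chain_ring_idempotent[OF chain])
  then show "x dvd 1"
  proof
    assume "r = 1"
    then have "x ^ N = 1" using r by (simp add: e_def)
    then show ?thesis using dvd_power[of N x] N(1) by simp
  next
    assume "r = 0"
    then have x0: "x ^ N = 0" using r by (simp add: e_def)
    \<comment> \<open>Here \<open>x\<close> is nilpotent. Iterating Frobenius makes a conjugate of
      \<open>x\<close> congruent to a power of \<open>x\<close> that is already 0, and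
      \<open>\<sigma>\<close> preserves divisibility by \<open>p\<close>, so \<open>p dvd x\<close>
      after all.\<close>
    have "p dvd (\<sigma> ^^ j) x - x ^ (?q ^ j)" for j
    proof (induction j)
      case (Suc j)
      have "p dvd \<sigma> ((\<sigma> ^^ j) x) - (\<sigma> ^^ j) x ^ ?q" by (rule frob)
      moreover have "p dvd (\<sigma> ^^ j) x ^ ?q - (x ^ (?q ^ j)) ^ ?q"
        by (rule p_dvd_diff_power[OF Suc])
      ultimately have "p dvd (\<sigma> ((\<sigma> ^^ j) x) - (\<sigma> ^^ j) x ^ ?q) + ((\<sigma> ^^ j) x ^ ?q - (x ^ (?q ^ j)) ^ ?q)"
        by (rule dvd_add)
      then show ?case by (simp add: power_mult[symmetric] mult.commute)
    qed simp
    moreover have "N \<le> ?q ^ N"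
      using power_gt_expt[OF residue_card_gt_1[unfolded One_nat_def], of N] by simp
    then have "x ^ (?q ^ N) = 0" using x0 by (metis le_Suc_ex mult_zero_left power_add)
    ultimately have "p dvd (\<sigma> ^^ N) x" by (metis diff_zero)
    moreover have "p dvd (\<sigma> ^^ j) x \<Longrightarrow> p dvd x" for j
      by (induction j) (auto simp: p_dvd_\<sigma>_iff)
    ultimately show ?thesis using nd by blast
  qed
qed

lemma p_dvd_unit_mult: "u dvd 1 \<Longrightarrow> p dvd u * x \<longleftrightarrow> p dvd x"
  by (metis dvd_def dvd_mult dvd_mult2 mult.assoc mult.commute mult.left_neutral)

section \<open>Residue classes of the base ring\<close>

lemma p_dvd_\<iota>_iff: "p dvd \<iota> r \<longleftrightarrow> \<pi> dvd r"
proof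
  assume "p dvd \<iota> r"
  then have "\<not> r dvd 1" using unit_S_iff by (metis \<iota>_1 \<iota>_mult dvd_def)
  then show "\<pi> dvd r" using unit_R_iff by blast
qed (rule p_dvd_\<iota>)

text \<open>Representatives stand in for the elements of the residue field: they are the known roots
  in \<open>fixed_mod_imp_base\<close> and the coefficient alphabet counted in
  \<open>rk_le_card_support\<close>.\<close>

lemma ex_transversal:
  obtains T :: "'r set" where "card T = residue_card (max_ideal :: 'r set)"
    "\<And>r. \<exists>t\<in>T. \<pi> dvd r - t" "\<And>t t'. t \<in> T \<Longrightarrow> t' \<in> T \<Longrightarrow> \<pi> dvd t - t' \<Longrightarrow> t = t'"
proof -
  define cl where "cl = (\<lambda>r :: 'r. {r'. r - r' \<in> max_ideal})"
  have cl_eq: "cl r = cl r'" if "\<pi> dvd r - r'" for r r'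
  proof -
    have "\<pi> dvd r - s \<longleftrightarrow> \<pi> dvd r' - s" for s
      using that dvd_add_right_iff[of \<pi> "r - r'" "r' - s"] by simp
    then show ?thesis by (simp add: cl_def max_ideal_R)
  qed
  have self: "r \<in> cl r" for r by (simp add: cl_def max_ideal_R)
  define rep where "rep = (\<lambda>C. SOME r. cl r = C)"
  have rep: "cl (rep (cl r)) = cl r" for r
    unfolding rep_def by (rule someI[of "\<lambda>s. cl s = cl r" r]) simp
  then have "inj_on rep (range cl)" by (intro inj_onI) (metis (no_types, lifting) imageE)
  then have "card (rep ` range cl) = residue_card (max_ideal :: 'r set)"
    by (simp add: card_image residue_card_def cl_def)
  moreover have "\<exists>t\<in>rep ` range cl. \<pi> dvd r - t" for r
  proof -
    have "rep (cl r) \<in> cl r" using rep self by metis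
    then show ?thesis by (auto simp: cl_def max_ideal_R)
  qed
  moreover have "t = t'" if "t \<in> rep ` range cl" "t' \<in> rep ` range cl" "\<pi> dvd t - t'" for t t'
    using that cl_eq rep by (metis (no_types, lifting) imageE)
  ultimately show thesis using that by blast
qed

text \<open>Elements fixed modulo \<open>p\<close> are roots of X^q - X modulo \<open>p\<close>,
  where q is the residue cardinality. Representatives of the base residues already give q roots, and
  a further class would exceed the degree.\<close>

lemma fixed_mod_imp_base:
  assumes "p dvd \<sigma> y - y"
  shows "\<exists>r. p dvd y - \<iota> r"
proof (rule ccontr)
  assume not: "\<not> ?thesis"
  let ?q = "residue_card (max_ideal :: 'r set)"
  obtain T :: "'r set" where T: "card T = ?q"
    "\<And>t t'. t \<in> T \<Longrightarrow> t' \<in> T \<Longrightarrow> \<pi> dvd t - t' \<Longrightarrow> t = t'"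
    using ex_transversal by metis
  define f :: "'s poly" where "f = monom 1 ?q - monom 1 1"
  have q: "?q > 1" by (rule residue_card_gt_1)
  have pf: "poly f z = z ^ ?q - z" for z by (simp add: f_def poly_monom)
  have root: "p dvd poly f z" if "p dvd \<sigma> z - z" for z
  proof -
    have "poly f z = (\<sigma> z - z) - (\<sigma> z - z ^ ?q)" by (simp add: pf)
    then show ?thesis using that frob[of z] by (metis dvd_diff)
  qed
  have "card (insert y (\<iota> ` T)) \<le> ?q"
  proof (rule card_roots_mod_le[OF p_not_unit])
    show "coeff f ?q = 1" using q by (simp add: f_def)
    show "degree f \<le> ?q" unfolding f_def using q
      by (intro degree_diff_le) (auto intro: order_trans[OF degree_monom_le])
    show "p dvd poly f z" if "z \<in> insert y (\<iota> ` T)" for z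
      using that assms by (intro root) auto
    have "(\<iota> t - \<iota> t') dvd 1" if "t \<in> T" "t' \<in> T" "\<iota> t \<noteq> \<iota> t'" for t t'
      unfolding unit_S_iff \<iota>_diff[symmetric] p_dvd_\<iota>_iff using T(2) that by blast
    moreover have "(y - \<iota> t) dvd 1" "(\<iota> t - y) dvd 1" for t
      unfolding unit_S_iff using not by (metis dvd_minus_iff minus_diff_eq)+
    ultimately show "(z - z') dvd 1" if "z \<in> insert y (\<iota> ` T)" "z' \<in> insert y (\<iota> ` T)" "z \<noteq> z'" for z z'
      using that by (elim insertE imageE) simp_all
  qed (auto simp: finite_S intro: finite_subset)
  moreover have "y \<notin> \<iota> ` T" using not by (metis diff_self dvd_0_right imageE)
  moreover have "card (\<iota> ` T) = ?q"
    using T(1) \<iota>_inj by (metis card_image inj_on_subset subset_UNIV)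
  ultimately show False by simp
qed

subsection \<open>Zeros of skew polynomials\<close>

lemma \<sigma>_pow_add: "(\<sigma> ^^ s) (x + y) = (\<sigma> ^^ s) x + (\<sigma> ^^ s) y"
  by (induction s) (auto simp: \<sigma>_add)

lemma \<sigma>_pow_mult: "(\<sigma> ^^ s) (x * y) = (\<sigma> ^^ s) x * (\<sigma> ^^ s) y"
  by (induction s) (auto simp: \<sigma>_mult)

lemma \<sigma>_pow_\<iota>: "(\<sigma> ^^ s) (\<iota> r) = \<iota> r"
  by (induction s) auto

lemma \<sigma>_pow_0: "(\<sigma> ^^ s) 0 = 0"
  by (induction s) auto

lemma Dop_0: "Dop \<sigma> a 0 x = x"
  by (simp add: Dop_def Nnorm_def)

text \<open>Shows \<open>Dop\<close> as the iteration of the additive map taking \<open>x\<close> to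
  \<open>\<sigma> x * a\<close>, which is how the skew variable acts and what division by a linear
  factor requires.\<close>

lemma Dop_Suc: "Dop \<sigma> a (Suc s) x = Dop \<sigma> a s (\<sigma> x * a)"
  by (simp add: Dop_def Nnorm_def \<sigma>_pow_mult funpow_swap1 mult_ac)

lemma Dop_add: "Dop \<sigma> a s (x + y) = Dop \<sigma> a s x + Dop \<sigma> a s y"
  by (simp add: Dop_def \<sigma>_pow_add algebra_simps)

lemma Dop_mult: "Dop \<sigma> a s (c * x) = (\<sigma> ^^ s) c * Dop \<sigma> a s x"
  by (simp add: Dop_def \<sigma>_pow_mult mult_ac)

lemma Dop_zero: "Dop \<sigma> a s 0 = 0"
  by (simp add: Dop_def \<sigma>_pow_0)

text \<open>Value at \<open>x\<close>, relative to \<open>a\<close>, of the skew polynomial with coefficients \<open>f\<close> of degree less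
  than \<open>k\<close>.\<close>

definition skew_eval :: "nat \<Rightarrow> (nat \<Rightarrow> 's) \<Rightarrow> 's \<Rightarrow> 's \<Rightarrow> 's" where
  "skew_eval k f a x = (\<Sum>s<k. f s * Dop \<sigma> a s x)"

lemma skew_eval_add: "skew_eval k f a (x + y) = skew_eval k f a x + skew_eval k f a y"
  by (simp add: skew_eval_def Dop_add algebra_simps sum.distrib)

lemma skew_eval_zero [simp]: "skew_eval k f a 0 = 0"
  by (simp add: skew_eval_def Dop_zero)

lemma skew_eval_\<iota>_mult: "skew_eval k f a (\<iota> r * x) = \<iota> r * skew_eval k f a x"
  by (simp add: skew_eval_def Dop_mult \<sigma>_pow_\<iota> sum_distrib_left mult.left_commute)

lemma skew_eval_sum: "skew_eval k f a (\<Sum>x\<in>X. \<iota> (c x) * g x) = (\<Sum>x\<in>X. \<iota> (c x) * skew_eval k f a (g x))"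
  by (induction X rule: infinite_finite_induct) (auto simp: skew_eval_add skew_eval_\<iota>_mult)

lemma skew_eval_smult: "skew_eval k (\<lambda>s. c * f s) a x = c * skew_eval k f a x"
  by (simp add: skew_eval_def sum_distrib_left mult_ac)

lemma skew_eval_diff: "skew_eval k (\<lambda>s. f s - g s) a x = skew_eval k f a x - skew_eval k g a x"
  by (simp add: skew_eval_def sum_subtractf algebra_simps)

text \<open>This is F = G (X - z) + r read on values, where X - z sends \<open>x\<close> to
  \<open>\<sigma> x * a - z * x\<close>; \<open>g\<close> and \<open>r\<close> do not depend on
  \<open>a\<close> or \<open>x\<close>. The second conjunct holds because multiplying back by X - z
  only combines coefficients of \<open>g\<close> and \<open>r\<close>.\<close>

lemma skew_right_division:
  fixes z :: 's
  shows   "\<exists>g r. (\<forall>a x. skew_eval (Suc k) f a x = skew_eval k g a (\<sigma> x * a - z * x) + r * x) \<and>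
     ((\<forall>s<k. d dvd g s) \<longrightarrow> d dvd r \<longrightarrow> (\<forall>s<Suc k. d dvd f s))"
proof (induction k arbitrary: f)
  case 0
  show ?case by (intro exI[of _ "\<lambda>_. 0"] exI[of _ "f 0"]) (simp add: skew_eval_def Dop_0)
next
  case (Suc k)
  \<comment> \<open>From X^(k+1) = X^k (X - z) + \<open>(\<sigma> ^^ k) z\<close> X^k: the top
    coefficient moves into the quotient and its remainder is folded into coefficient
    \<open>k\<close>.\<close>
  define f' where "f' = f(k := f k + f (Suc k) * (\<sigma> ^^ k) z)"
  obtain g r where g: "\<And>a x. skew_eval (Suc k) f' a x = skew_eval k g a (\<sigma> x * a - z * x) + r * x"
    and dvd: "(\<forall>s<k. d dvd g s) \<Longrightarrow> d dvd r \<Longrightarrow> (\<forall>s<Suc k. d dvd f' s)"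
    using Suc.IH[of f'] by blast
  define g' where "g' = g(k := f (Suc k))"
  have "skew_eval (Suc (Suc k)) f a x = skew_eval (Suc k) g' a (\<sigma> x * a - z * x) + r * x" for a x
  proof -
    have "Dop \<sigma> a (Suc k) x = Dop \<sigma> a k ((\<sigma> x * a - z * x) + z * x)" by (simp add: Dop_Suc)
    then have D: "Dop \<sigma> a (Suc k) x = Dop \<sigma> a k (\<sigma> x * a - z * x) + (\<sigma> ^^ k) z * Dop \<sigma> a k x"
      by (simp only: Dop_add Dop_mult)
    have "skew_eval (Suc (Suc k)) f a x = f (Suc k) * Dop \<sigma> a k (\<sigma> x * a - z * x) + skew_eval (Suc k) f' a x"
      unfolding skew_eval_def by (simp add: f'_def D algebra_simps)
    also have "\<dots> = skew_eval (Suc k) g' a (\<sigma> x * a - z * x) + r * x"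
      unfolding g by (simp add: skew_eval_def g'_def)
    finally show ?thesis .
  qed
  moreover have "\<forall>s<Suc (Suc k). d dvd f s" if g': "\<forall>s<Suc k. d dvd g' s" and r: "d dvd r"
  proof -
    have "d dvd g s" if "s < k" for s using g'[rule_format, of s] that by (simp add: g'_def)
    then have f': "d dvd f' s" if "s < Suc k" for s using dvd r that by blast
    have top: "d dvd f (Suc k)" using g'[rule_format, of k] by (simp add: g'_def)
    have "d dvd f k"
      using f'[of k] top by (simp add: f'_def dvd_add_left_iff)
    moreover have "d dvd f s" if "s < k" for s using f'[of s] that by (simp add: f'_def)
    ultimately show ?thesis using top by (auto simp: less_Suc_eq)
  qed
  ultimately show ?case by blast
qed

lemma sinv_mult: "u dvd 1 \<Longrightarrow> u * sinv u = (1 :: 's)"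
  unfolding sinv_def by (rule someI_ex) (auto simp: dvd_def)

lemma sinv_unit: "u dvd 1 \<Longrightarrow> sinv u dvd (1 :: 's)"
  using sinv_mult by (metis dvd_triv_right)

lemma unit_mult: "x dvd 1 \<Longrightarrow> y dvd 1 \<Longrightarrow> x * y dvd (1 :: 's)"
  using mult_dvd_mono[of x 1 y 1] by simp

text \<open>With \<open>u\<close> the quotient of \<open>y\<close> by \<open>x\<close>, the
  difference equals \<open>\<sigma> x * y\<close> times \<open>a - sconj \<sigma> a' u\<close>, a
  product of units. This clears denominators in the conjugacy condition.\<close>

lemma not_conj_mod:
  assumes conj: "\<And>u. u dvd 1 \<Longrightarrow> (a - sconj \<sigma> a' u) dvd 1"
    and x: "x dvd 1" and y: "y dvd 1"
  shows "\<not> p dvd \<sigma> x * a * y - \<sigma> y * a' * x"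
proof -
  define u where "u = y * sinv x"
  have u: "u dvd 1" unfolding u_def using x y by (intro unit_mult sinv_unit)
  have y_eq: "y = u * x" using sinv_mult[OF x] by (simp add: u_def mult.assoc mult.commute[of "sinv x"])
  have "(\<sigma> x * y) * (a - sconj \<sigma> a' u) = \<sigma> x * a * y - \<sigma> (u * x) * a' * (u * sinv u) * x"
    unfolding sconj_def y_eq \<sigma>_mult by (simp add: algebra_simps)
  also have "\<dots> = \<sigma> x * a * y - \<sigma> y * a' * x"
    using sinv_mult[OF u] by (simp add: y_eq)
  finally have "\<sigma> x * a * y - \<sigma> y * a' * x dvd 1"
    using conj[OF u] x y \<sigma>_unit by (metis unit_mult)
  then show ?thesis using unit_S_iff by blast
qed

text \<open>Dividing by \<open>X - b\<close>, where \<open>b\<close> is the conjugate of \<open>a i\<^sub>0\<close> by the root \<open>\<beta> i\<^sub>0 j\<^sub>0\<close>, replaces each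
  remaining root \<open>x\<close> by \<open>\<sigma> x * a i - b * x\<close>; this map has no kernel modulo the maximal ideal in the
  other conjugacy classes, and only the line through \<open>\<beta> i\<^sub>0 j\<^sub>0\<close> in its own one.\<close>

lemma skew_zeros_mod:
  fixes a :: "nat \<Rightarrow> 's" and \<beta> :: "nat \<Rightarrow> nat \<Rightarrow> 's" and T :: "(nat \<times> nat) set"
  assumes a_units: "\<And>i. i < l \<Longrightarrow> a i dvd 1"
    and conj: "\<And>i j u. i < j \<Longrightarrow> j < l \<Longrightarrow> u dvd 1 \<Longrightarrow> (a i - sconj \<sigma> (a j) u) dvd 1"
    and "finite T" "card T = k" "\<And>i j. (i, j) \<in> T \<Longrightarrow> i < l"
    and "\<And>i j c. p dvd (\<Sum>j\<in>{j. (i, j) \<in> T}. \<iota> (c j) * \<beta> i j) \<Longrightarrow> (i, j) \<in> T \<Longrightarrow> p dvd \<iota> (c j)"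
    and "\<And>i j. (i, j) \<in> T \<Longrightarrow> p dvd skew_eval k f (a i) (\<beta> i j)"
  shows "\<forall>s<k. p dvd f s"
  using assms(3-)
proof (induction k arbitrary: T \<beta> f)
  case (Suc k)
  note fin = Suc.prems(1) and T_l = Suc.prems(3) and indep = Suc.prems(4) and zero = Suc.prems(5)
  obtain i0 j0 where ij0: "(i0, j0) \<in> T"
    using Suc.prems(2) by (metis card.empty equals0I nat.distinct(1) surj_pair)
  define Ti where "Ti = (\<lambda>i. {j. (i, j) \<in> T})"
  have fin_Ti: "finite (Ti i)" for i
  proof -
    have "Ti i \<subseteq> snd ` T" unfolding Ti_def by force
    then show ?thesis using fin finite_surj by blast
  qed
  define x0 where "x0 = \<beta> i0 j0"
  \<comment> \<open>An indicator coefficient in the independence hypothesis shows that a single root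
    is nonzero modulo \<open>p\<close>.\<close>
  have x0: "x0 dvd 1"
    unfolding unit_S_iff
  proof
    assume "p dvd x0"
    moreover have "(\<Sum>j\<in>Ti i0. \<iota> (if j = j0 then 1 else 0) * \<beta> i0 j) = (\<Sum>j\<in>Ti i0. if j = j0 then x0 else 0)"
      by (intro sum.cong) (auto simp: x0_def)
    then have "(\<Sum>j\<in>Ti i0. \<iota> (if j = j0 then 1 else 0) * \<beta> i0 j) = x0"
      using ij0 fin_Ti by (simp add: Ti_def)
    ultimately have "p dvd \<iota> (if j0 = j0 then 1 else 0)"
      using indep[where i = i0 and c = "\<lambda>j. if j = j0 then 1 else 0" and j = j0] ij0 unfolding Ti_def by simp
    then show False using p_not_unit by simp
  qed
  define bb where "bb = \<sigma> x0 * a i0 * sinv x0"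
  have bb: "bb * x0 = \<sigma> x0 * a i0"
    using sinv_mult[OF x0] by (simp add: bb_def mult.assoc mult.commute[of "sinv x0"])
  obtain g r where g: "\<And>a x. skew_eval (Suc k) f a x = skew_eval k g a (\<sigma> x * a - bb * x) + r * x"
    and dvd: "(\<forall>s<k. p dvd g s) \<Longrightarrow> p dvd r \<Longrightarrow> (\<forall>s<Suc k. p dvd f s)"
    using skew_right_division[of k f bb p] by blast
  \<comment> \<open>At \<open>x0\<close> the linear factor vanishes by the choice of
    \<open>bb\<close>, so only \<open>r * x0\<close> is left, and \<open>x0\<close> is a
    unit.\<close>
  have r: "p dvd r"
    using zero[OF ij0] g[of "a i0" x0] p_dvd_unit_mult[OF x0, of r] by (simp add: bb x0_def[symmetric] mult.commute)
  define T' where "T' = T - {(i0, j0)}"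
  define \<beta>' where "\<beta>' = (\<lambda>i j. \<sigma> (\<beta> i j) * a i - bb * \<beta> i j)"
  have "\<forall>s<k. p dvd g s"
  proof (rule Suc.IH[of T' \<beta>'])
    show "finite T'" "card T' = k" using fin Suc.prems(2) ij0 by (auto simp: T'_def)
    show "i < l" if "(i, j) \<in> T'" for i j using that T_l by (auto simp: T'_def)
    show "p dvd skew_eval k g (a i) (\<beta>' i j)" if "(i, j) \<in> T'" for i j
    proof -
      have "p dvd skew_eval k g (a i) (\<beta>' i j) + r * \<beta> i j"
        using zero[of i j] that g[of "a i" "\<beta> i j"] by (simp add: T'_def \<beta>'_def)
      then show ?thesis using r by (simp add: dvd_add_left_iff)
    qed
    show "p dvd \<iota> (c j)"
      if dvd_sum: "p dvd (\<Sum>j\<in>{j. (i, j) \<in> T'}. \<iota> (c j) * \<beta>' i j)" and ij: "(i, j) \<in> T'" for i j c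
    proof -
      define Ti' where "Ti' = {j. (i, j) \<in> T'}"
      have Ti': "Ti' \<subseteq> Ti i" "finite Ti'"
        using fin_Ti[of i] by (auto simp: Ti'_def Ti_def T'_def intro: finite_subset)
      define \<gamma> where "\<gamma> = (\<Sum>j\<in>Ti'. \<iota> (c j) * \<beta> i j)"
      have "(\<Sum>j\<in>Ti'. \<iota> (c j) * \<beta>' i j) = \<sigma> \<gamma> * a i - bb * \<gamma>"
        by (simp add: \<gamma>_def \<beta>'_def \<sigma>_sum \<sigma>_mult sum_distrib_left sum_distrib_right
            sum_subtractf algebra_simps)
      then have "p dvd \<sigma> \<gamma> * a i - bb * \<gamma>" using dvd_sum by (simp add: Ti'_def)
      \<comment> \<open>A combination of new roots is the image of the same combination
        \<open>\<gamma>\<close> of old ones. Multiplying by \<open>x0\<close> removes the inverse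
        hidden in \<open>bb\<close>.\<close>
      then have "p dvd (\<sigma> \<gamma> * a i - bb * \<gamma>) * x0" by (rule dvd_mult2)
      also have "(\<sigma> \<gamma> * a i - bb * \<gamma>) * x0 = \<sigma> \<gamma> * a i * x0 - bb * x0 * \<gamma>"
        by (simp add: algebra_simps)
      finally have key: "p dvd \<sigma> \<gamma> * a i * x0 - \<sigma> x0 * a i0 * \<gamma>" unfolding bb .
      have il: "i < l" "i0 < l" using ij ij0 T_l by (auto simp: T'_def)
      have "p dvd \<gamma>"
      proof (rule ccontr)
        assume nd: "\<not> p dvd \<gamma>"
        then have \<gamma>: "\<gamma> dvd 1" by (simp add: unit_S_iff)
        consider "i < i0" | "i0 < i" | "i = i0" by linarith
        then show False
        proof cases
          case 1
          then show False using not_conj_mod[OF conj[OF 1 il(2)] \<gamma> x0] key by blast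
        next
          case 2
          have "p dvd \<sigma> x0 * a i0 * \<gamma> - \<sigma> \<gamma> * a i * x0" using key by (metis dvd_minus_iff minus_diff_eq)
          then show False using not_conj_mod[OF conj[OF 2 il(1)] x0 \<gamma>] by blast
        next
          case 3
          \<comment> \<open>In the same class, the quotient of \<open>\<gamma>\<close> by
            \<open>x0\<close> is fixed modulo \<open>p\<close>, hence congruent to a base element
            \<open>t\<close>.\<close>
          define \<delta> where "\<delta> = \<gamma> * sinv x0"
          have \<gamma>_eq: "\<gamma> = \<delta> * x0" using sinv_mult[OF x0] by (simp add: \<delta>_def mult.assoc mult.commute[of "sinv x0"])
          have "p dvd (a i0 * (\<sigma> x0 * x0)) * (\<sigma> \<delta> - \<delta>)"
            using key unfolding 3 \<gamma>_eq \<sigma>_mult by (simp add: algebra_simps)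
          moreover have "(a i0 * (\<sigma> x0 * x0)) dvd 1"
            using x0 \<sigma>_unit[OF x0] a_units[OF il(2)] by (intro unit_mult)
          ultimately have "p dvd \<sigma> \<delta> - \<delta>" using p_dvd_unit_mult by blast
          then obtain t where "p dvd \<delta> - \<iota> t" using fixed_mod_imp_base by blast
          then have t: "p dvd \<gamma> - \<iota> t * x0"
            unfolding \<gamma>_eq by (metis dvd_mult2 left_diff_distrib)
          have ins: "Ti i = insert j0 Ti'" "j0 \<notin> Ti'"
            using ij0 by (auto simp: Ti_def Ti'_def T'_def 3)
          \<comment> \<open>\<open>\<gamma>\<close> congruent to \<open>\<iota> t * x0\<close> is a
            relation among the old roots, with \<open>- t\<close> placed at the removed index
            \<open>j0\<close>.\<close>
          define c' where "c' = c(j0 := - t)"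
          have "(\<Sum>j\<in>Ti i. \<iota> (c' j) * \<beta> i j) = \<gamma> - \<iota> t * x0"
          proof -
            have "(\<Sum>j\<in>Ti'. \<iota> (c' j) * \<beta> i j) = \<gamma>"
              unfolding \<gamma>_def using ins(2) by (intro sum.cong) (auto simp: c'_def)
            then show ?thesis unfolding ins(1) using Ti'(2) ins(2)
              by (simp add: c'_def \<iota>_minus x0_def 3)
          qed
          then have "p dvd \<iota> (c' j0)"
            using indep[where i = i and c = c' and j = j0] t ij0 by (simp add: Ti_def 3)
          then have "p dvd \<iota> t * x0" by (simp add: c'_def \<iota>_minus)
          then have "p dvd \<gamma>" using t by (metis diff_add_cancel dvd_add)
          then show False using nd by blast
        qed
      qed
      moreover have "(\<Sum>j\<in>Ti i. \<iota> (if j \<in> Ti' then c j else 0) * \<beta> i j) = \<gamma>"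
        unfolding \<gamma>_def using Ti' fin_Ti by (intro sum.mono_neutral_cong_right) auto
      ultimately have "p dvd \<iota> (if j \<in> Ti' then c j else 0)"
        using indep[where i = i and c = "\<lambda>j. if j \<in> Ti' then c j else 0" and j = j] ij by (simp add: Ti_def T'_def)
      then show ?thesis using ij by (simp add: Ti'_def)
    qed
  qed
  then show ?case using dvd r by blast
qed simp

section \<open>From the residue field back to the ring\<close>

text \<open>The last nonzero power of \<open>\<pi>\<close> serves; it turns relations modulo
  \<open>\<pi>\<close> into exact ones.\<close>

lemma ex_socle_element: "\<exists>w. w \<noteq> 0 \<and> w * \<pi> = 0"
proof -
  define N where "N = (LEAST N. \<pi> ^ N = 0)"
  have N: "\<pi> ^ N = 0" unfolding N_def by (rule LeastI_ex[OF \<pi>_nilpotent])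
  have "(1 :: 'r) \<noteq> 0" using zero_neq_one_S by (metis \<iota>_0 \<iota>_1)
  then have "N \<noteq> 0" using N by (metis power_0)
  then obtain N' where N': "N = Suc N'" by (metis not0_implies_Suc)
  then have "\<pi> ^ N' \<noteq> 0" using not_less_Least[of N' "\<lambda>N. \<pi> ^ N = 0"] by (simp add: N_def)
  then show ?thesis using N N' by (metis power_Suc2)
qed

lemma skew_zeros_imp_zero:
  fixes a :: "nat \<Rightarrow> 's" and \<beta> :: "nat \<Rightarrow> nat \<Rightarrow> 's" and T :: "(nat \<times> nat) set"
  assumes a_units: "\<And>i. i < l \<Longrightarrow> a i dvd 1"
    and conj: "\<And>i j u. i < j \<Longrightarrow> j < l \<Longrightarrow> u dvd 1 \<Longrightarrow> (a i - sconj \<sigma> (a j) u) dvd 1"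
    and indep: "\<And>i c. i < l \<Longrightarrow> (\<Sum>j<ns i. \<iota> (c j) * \<beta> i j) = 0 \<Longrightarrow> \<forall>j<ns i. c j = 0"
    and T: "finite T" "k \<le> card T" "\<And>i j. (i, j) \<in> T \<Longrightarrow> i < l \<and> j < ns i"
    and zero: "\<And>i j. (i, j) \<in> T \<Longrightarrow> skew_eval k f (a i) (\<beta> i j) = 0"
  shows "\<forall>s<k. f s = 0"
proof (rule ccontr)
  assume "\<not> ?thesis"
  then obtain s0 where s0: "s0 < k" "f s0 \<noteq> 0" by blast
  obtain N where N: "p ^ N = 0" using p_nilpotent by blast
  \<comment> \<open>\<open>e\<close> is the first power of \<open>p\<close> that fails to divide all
    coefficients, so \<open>e'\<close> is the largest that succeeds. It remains to show that
    \<open>p\<close> divides every \<open>g s\<close>, contradicting this.\<close>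
  define e where "e = (LEAST e. \<not> (\<forall>s<k. p ^ e dvd f s))"
  have "\<not> (\<forall>s<k. p ^ N dvd f s)" using s0 N by auto
  then have e: "\<not> (\<forall>s<k. p ^ e dvd f s)" unfolding e_def by (rule LeastI)
  then have "e \<noteq> 0" by (metis one_dvd power_0)
  then obtain e' where e': "e = Suc e'" by (metis not0_implies_Suc)
  then have "\<forall>s<k. p ^ e' dvd f s"
    using not_less_Least[of e' "\<lambda>e. \<not> (\<forall>s<k. p ^ e dvd f s)"] by (simp add: e_def)
  then obtain g where g: "\<And>s. s < k \<Longrightarrow> f s = p ^ e' * g s"
    unfolding dvd_def by metis
  have pe: "p ^ e' \<noteq> 0" using g[OF s0(1)] s0(2) by auto
  obtain T' where T': "T' \<subseteq> T" "card T' = k" "finite T'"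
    using T(1,2) by (meson obtain_subset_with_card_n finite_subset)
  obtain w where w: "w \<noteq> 0" "w * \<pi> = 0" using ex_socle_element by blast
  have "\<forall>s<k. p dvd g s"
  proof (rule skew_zeros_mod[where T = T' and \<beta> = \<beta>, OF a_units conj])
    show "p dvd skew_eval k g (a i) (\<beta> i j)" if "(i, j) \<in> T'" for i j
    proof (rule ccontr)
      assume "\<not> ?thesis"
      then obtain v where v: "1 = skew_eval k g (a i) (\<beta> i j) * v"
        unfolding unit_S_iff[symmetric] by auto
      have "skew_eval k f (a i) (\<beta> i j) = skew_eval k (\<lambda>s. p ^ e' * g s) (a i) (\<beta> i j)"
        unfolding skew_eval_def using g by simp
      then have "p ^ e' * skew_eval k g (a i) (\<beta> i j) = 0"
        using zero[of i j] that T' by (simp add: skew_eval_smult subset_iff)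
      then have "p ^ e' * 1 = 0" by (metis v mult.assoc mult_zero_left)
      then show False using pe by simp
    qed
    show "p dvd \<iota> (c j)"
      if dvd: "p dvd (\<Sum>j\<in>{j. (i, j) \<in> T'}. \<iota> (c j) * \<beta> i j)" and ij: "(i, j) \<in> T'" for i j c
    proof -
      define X where "X = {j. (i, j) \<in> T'}"
      have X: "X \<subseteq> {..<ns i}" and il: "i < l" using T(3) T' ij by (auto simp: X_def)
      obtain v where v: "(\<Sum>j\<in>X. \<iota> (c j) * \<beta> i j) = p * v" using dvd by (auto simp: X_def)
      \<comment> \<open>Multiplication by \<open>w\<close> kills the right-hand side
        \<open>p * v\<close>. Exact independence then gives \<open>w * c j = 0\<close>, which is
        impossible for a unit \<open>c j\<close>.\<close>
      have "(\<Sum>j<ns i. \<iota> (if j \<in> X then w * c j else 0) * \<beta> i j) = (\<Sum>j\<in>X. \<iota> w * (\<iota> (c j) * \<beta> i j))"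
        using X by (intro sum.mono_neutral_cong_right) (auto simp: \<iota>_mult mult_ac)
      also have "\<dots> = \<iota> w * (p * v)" by (simp add: sum_distrib_left[symmetric] v)
      also have "\<dots> = \<iota> (w * \<pi>) * v" by (simp add: \<iota>_mult mult_ac)
      also have "\<dots> = 0" using w by simp
      finally have "\<forall>j<ns i. (if j \<in> X then w * c j else 0) = 0" by (rule indep[OF il])
      then have wc: "w * c j = 0" using ij X by (auto simp: X_def)
      have "\<not> c j dvd 1"
      proof
        assume "c j dvd 1"
        then obtain u where "1 = c j * u" by auto
        then have "w = w * c j * u" by (metis mult.assoc mult.right_neutral)
        with wc w show False by simp
      qed
      then show ?thesis by (simp add: unit_R_iff p_dvd_\<iota>)
    qed
  qed (use T' T in \<open>auto simp: subset_iff\<close>)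
  then have "p ^ e dvd f s" if "s < k" for s
    using that g[of s] by (simp add: e' mult_dvd_mono mult.commute[of _ "p ^ e'"])
  then show False using e by blast
qed

subsection \<open>Rank of a block\<close>

lemma basis_indep:
  assumes "(\<Sum>i<m. \<iota> (c i) * b i) = 0" "i < m"
  shows "c i = 0"
proof -
  define c' where "c' = (\<lambda>i. if i < m then c i else 0)"
  have "(\<Sum>i<m. \<iota> (c' i) * b i) = (\<Sum>i<m. \<iota> ((\<lambda>_. 0) i) * b i)"
    using assms by (simp add: c'_def)
  then have "c' = (\<lambda>_. 0)"
    by (rule inj_onD[OF bij_betw_imp_inj_on[OF basis]]) (simp_all add: c'_def)
  then show ?thesis using assms(2) unfolding c'_def by metis
qed

lemma coords_sum: "(\<Sum>i<m. \<iota> (coords \<iota> b m x i) * b i) = x"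
proof -
  let ?P = "\<lambda>c. (\<forall>i\<ge>m. c i = 0) \<and> x = (\<Sum>i<m. \<iota> (c i) * b i)"
  have "x \<in> (\<lambda>c. \<Sum>i<m. \<iota> (c i) * b i) ` {c. \<forall>i\<ge>m. c i = 0}"
    using bij_betw_imp_surj_on[OF basis] by simp
  then obtain c where c: "?P c" by blast
  have "c' = c" if c': "?P c'" for c'
    by (rule inj_onD[OF bij_betw_imp_inj_on[OF basis]]) (use c c' in simp_all)
  with c have "?P (THE c. ?P c)" by (rule theI)
  then show ?thesis unfolding coords_def by simp
qed

text \<open>The columns of \<open>A * Q\<close> are the coordinate vectors of the entries of the
  block multiplied by \<open>Q\<close>, so the matrix statement becomes one about the elements
  \<open>v j\<close>. The left inverse \<open>Q'\<close> is exported to transfer independence of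
  evaluation points.\<close>

lemma rk_witness:
  fixes u :: "nat \<Rightarrow> 's"
  obtains Q Q' :: "nat \<Rightarrow> nat \<Rightarrow> 'r" and v where
    "\<And>i j. i < t \<Longrightarrow> j < t \<Longrightarrow> (\<Sum>s<t. Q' i s * Q s j) = (if i = j then 1 else 0)"
    "v = (\<lambda>j. \<Sum>i<t. \<iota> (Q i j) * u i)"
    "rk \<iota> b m u t = card {j. j < t \<and> v j \<noteq> 0}"
    "\<And>x j. (\<Sum>j<t. \<iota> (x j) * v j) = 0 \<Longrightarrow> j < t \<Longrightarrow> v j \<noteq> 0 \<Longrightarrow> \<pi> dvd x j"
proof -
  define A where "A = mat m t (\<lambda>(i, j). coords \<iota> b m (u j) i)"
  have A: "A \<in> carrier_mat m t" by (simp add: A_def)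
  obtain Q Q' where Q: "Q \<in> carrier_mat t t" "Q' \<in> carrier_mat t t" and "Q * Q' = 1\<^sub>m t"
    and Q'Q: "Q' * Q = 1\<^sub>m t"
    and rank: "snf_rank A = card {j. j < t \<and> (\<exists>i<m. (A * Q) $$ (i, j) \<noteq> 0)}"
    and nonunit: "\<forall>x j. (\<forall>i<m. (\<Sum>j<t. (A * Q) $$ (i, j) * x j) = 0) \<longrightarrow> j < t \<longrightarrow>
       (\<exists>i<m. (A * Q) $$ (i, j) \<noteq> 0) \<longrightarrow> \<not> x j dvd 1"
    by (rule snf_rank_witness[OF chain_ring_dvd_total[OF chain] A]) (rule that)
  define v where "v = (\<lambda>j. \<Sum>i<t. \<iota> (Q $$ (i, j)) * u i)"
  have AQ: "(A * Q) $$ (i, j) = (\<Sum>s<t. coords \<iota> b m (u s) i * Q $$ (s, j))" if "i < m" "j < t" for i j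
    using that Q A by (simp add: scalar_prod_def atLeast0LessThan A_def)
  have v_eq: "v j = (\<Sum>i<m. \<iota> ((A * Q) $$ (i, j)) * b i)" if j: "j < t" for j
  proof -
    have "v j = (\<Sum>s<t. \<iota> (Q $$ (s, j)) * (\<Sum>i<m. \<iota> (coords \<iota> b m (u s) i) * b i))"
      by (simp add: v_def coords_sum)
    also have "\<dots> = (\<Sum>i<m. \<Sum>s<t. \<iota> (Q $$ (s, j)) * (\<iota> (coords \<iota> b m (u s) i) * b i))"
      unfolding sum_distrib_left by (rule sum.swap)
    also have "\<dots> = (\<Sum>i<m. \<iota> ((A * Q) $$ (i, j)) * b i)"
      using j by (intro sum.cong) (auto simp: AQ \<iota>_sum \<iota>_mult sum_distrib_left mult_ac)
    finally show ?thesis .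
  qed
  have v_nz: "v j \<noteq> 0 \<longleftrightarrow> (\<exists>i<m. (A * Q) $$ (i, j) \<noteq> 0)" if j: "j < t" for j
  proof -
    have "(A * Q) $$ (i, j) = 0" if "v j = 0" "i < m" for i
      using basis_indep[of "\<lambda>i. (A * Q) $$ (i, j)" i] that v_eq[OF j] by simp
    moreover have "v j = 0" if "\<forall>i<m. (A * Q) $$ (i, j) = 0"
      using that v_eq[OF j] by simp
    ultimately show ?thesis by metis
  qed
  show thesis
  proof (rule that[of "\<lambda>i j. Q' $$ (i, j)" "\<lambda>i j. Q $$ (i, j)" v])
    show "(\<Sum>s<t. Q' $$ (i, s) * Q $$ (s, j)) = (if i = j then 1 else 0)" if "i < t" "j < t" for i j
    proof -
      have "(Q' * Q) $$ (i, j) = (\<Sum>s<t. Q' $$ (i, s) * Q $$ (s, j))"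
        using that Q by (simp add: scalar_prod_def atLeast0LessThan)
      then show ?thesis using that Q'Q by simp
    qed
    have "{j. j < t \<and> v j \<noteq> 0} = {j. j < t \<and> (\<exists>i<m. (A * Q) $$ (i, j) \<noteq> 0)}"
      using v_nz by blast
    then show "rk \<iota> b m u t = card {j. j < t \<and> v j \<noteq> 0}"
      using rank by (simp add: rk_def A_def)
    show "\<pi> dvd x j" if x: "(\<Sum>j<t. \<iota> (x j) * v j) = 0" and j: "j < t" "v j \<noteq> 0" for x j
    proof -
      have "(\<Sum>j<t. \<iota> (x j) * v j) = (\<Sum>j<t. \<Sum>i<m. \<iota> ((A * Q) $$ (i, j) * x j) * b i)"
        by (intro sum.cong) (auto simp: v_eq sum_distrib_left \<iota>_mult mult_ac)
      also have "\<dots> = (\<Sum>i<m. \<iota> (\<Sum>j<t. (A * Q) $$ (i, j) * x j) * b i)"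
        by (subst sum.swap) (simp add: \<iota>_sum sum_distrib_right)
      finally have "(\<Sum>j<t. (A * Q) $$ (i, j) * x j) = 0" if "i < m" for i
        using basis_indep[OF _ that, of "\<lambda>i. \<Sum>j<t. (A * Q) $$ (i, j) * x j"] x by simp
      then have "\<not> x j dvd 1" using nonunit v_nz[OF j(1)] j by simp
      then show ?thesis by (simp add: unit_R_iff)
    qed
  qed (simp add: v_def)
qed

text \<open>Because \<open>p\<close> kills every \<open>u i\<close>, a combination of the
  \<open>v j\<close> is determined by the residues of the coefficients that \<open>Q\<close>
  produces at the positions in \<open>Z\<close>. Relations among nonzero \<open>v j\<close> have
  coefficients divisible by \<open>\<pi>\<close>, so residue vectors on \<open>J\<close> inject into
  residue vectors on \<open>Z\<close>.\<close>

lemma rk_le_card_support: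
  assumes Z: "Z \<subseteq> {..<t}" "\<And>j. j < t \<Longrightarrow> j \<notin> Z \<Longrightarrow> u j = 0"
    and socle: "\<And>j. j < t \<Longrightarrow> p * u j = 0"
  shows "rk \<iota> b m u t \<le> card Z"
proof -
  obtain Q Q' :: "nat \<Rightarrow> nat \<Rightarrow> 'r" and v where
    "\<And>i j. i < t \<Longrightarrow> j < t \<Longrightarrow> (\<Sum>s<t. Q' i s * Q s j) = (if i = j then 1 else 0)" and
    v: "v = (\<lambda>j. \<Sum>i<t. \<iota> (Q i j) * u i)" and
    rk: "rk \<iota> b m u t = card {j. j < t \<and> v j \<noteq> 0}" and
    nonunit: "\<And>x j. (\<Sum>j<t. \<iota> (x j) * v j) = 0 \<Longrightarrow> j < t \<Longrightarrow> v j \<noteq> 0 \<Longrightarrow> \<pi> dvd x j"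
    by (rule rk_witness[where t = t and u = u]) (rule that)
  define J where "J = {j. j < t \<and> v j \<noteq> 0}"
  have J: "finite J" "J \<subseteq> {..<t}" by (auto simp: J_def)
  have finZ: "finite Z" using Z finite_subset by blast
  obtain T :: "'r set" where T: "card T = residue_card (max_ideal :: 'r set)"
    "\<And>r. \<exists>t\<in>T. \<pi> dvd r - t" "\<And>t t'. t \<in> T \<Longrightarrow> t' \<in> T \<Longrightarrow> \<pi> dvd t - t' \<Longrightarrow> t = t'"
    using ex_transversal by metis
  obtain rep where rep: "\<And>r. rep r \<in> T" "\<And>r. \<pi> dvd r - rep r"
    using T(2) by metis
  define \<Phi> where "\<Phi> = (\<lambda>x. restrict (\<lambda>i. rep (\<Sum>j\<in>J. Q i j * x j)) Z)"
  have "inj_on \<Phi> (J \<rightarrow>\<^sub>E T)"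
  proof (rule inj_onI)
    fix x y assume x: "x \<in> J \<rightarrow>\<^sub>E T" and y: "y \<in> J \<rightarrow>\<^sub>E T" and eq: "\<Phi> x = \<Phi> y"
    define d where "d = (\<lambda>j. if j \<in> J then x j - y j else 0)"
    define w where "w = (\<lambda>i. \<Sum>j\<in>J. Q i j * (x j - y j))"
    have w: "\<pi> dvd w i" if "i \<in> Z" for i
    proof -
      let ?sx = "\<Sum>j\<in>J. Q i j * x j" and ?sy = "\<Sum>j\<in>J. Q i j * y j"
      have "rep ?sx = rep ?sy" using fun_cong[OF eq, of i] that by (simp add: \<Phi>_def)
      then have "w i = (?sx - rep ?sx) - (?sy - rep ?sy)"
        by (simp add: w_def right_diff_distrib sum_subtractf)
      then show ?thesis using rep(2) by (simp add: dvd_diff)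
    qed
    have "(\<Sum>j<t. \<iota> (d j) * v j) = (\<Sum>j\<in>J. \<iota> (x j - y j) * v j)"
      using J by (intro sum.mono_neutral_cong_right) (auto simp: d_def)
    also have "\<dots> = (\<Sum>j\<in>J. \<Sum>i<t. \<iota> (Q i j * (x j - y j)) * u i)"
      by (intro sum.cong) (auto simp: v sum_distrib_left \<iota>_mult mult_ac)
    also have "\<dots> = (\<Sum>i<t. \<iota> (w i) * u i)"
      by (subst sum.swap) (simp add: w_def \<iota>_sum sum_distrib_right)
    also have "\<dots> = 0"
    proof (rule sum.neutral, rule ballI)
      fix i assume i: "i \<in> {..<t}"
      show "\<iota> (w i) * u i = 0"
      proof (cases "i \<in> Z")
        case True
        then obtain z where "w i = \<pi> * z" using w by blast
        then have "\<iota> (w i) * u i = \<iota> z * (p * u i)" by (simp add: \<iota>_mult mult_ac)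
        then show ?thesis using socle i by simp
      qed (use Z i in simp)
    qed
    finally have "\<pi> dvd d j" if "j \<in> J" for j
      using nonunit[of d j] that by (simp add: J_def)
    then have "x j = y j" if "j \<in> J" for j
      using that T(3)[of "x j" "y j"] x y by (auto simp: d_def)
    then show "x = y" using x y by (intro PiE_ext)
  qed
  moreover have "\<Phi> ` (J \<rightarrow>\<^sub>E T) \<subseteq> Z \<rightarrow>\<^sub>E T"
    using rep(1) by (auto simp: \<Phi>_def)
  moreover have "finite (Z \<rightarrow>\<^sub>E T)" using finZ by (simp add: finite_PiE)
  ultimately have "card (J \<rightarrow>\<^sub>E T) \<le> card (Z \<rightarrow>\<^sub>E T)"
    by (metis card_inj_on_le)
  then have "residue_card (max_ideal :: 'r set) ^ card J \<le> residue_card (max_ideal :: 'r set) ^ card Z"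
    using J finZ by (simp add: card_PiE T(1))
  then have "card J \<le> card Z" using residue_card_gt_1 by simp
  then show ?thesis using rk by (simp add: J_def)
qed

end

section \<open>Linearized Reed--Solomon codes\<close>

locale linearized_RS_code = chain_ring_extension \<iota> \<sigma> b m
  for \<iota> :: "'r::{comm_ring_1,finite} \<Rightarrow> 's::comm_ring_1" and \<sigma> b m +
  fixes l :: nat and ns :: "nat \<Rightarrow> nat" and a :: "nat \<Rightarrow> 's" and \<beta> :: "nat \<Rightarrow> nat \<Rightarrow> 's"
  assumes a_units: "i < l \<Longrightarrow> a i dvd 1"
    and conj: "i < j \<Longrightarrow> j < l \<Longrightarrow> u dvd 1 \<Longrightarrow> (a i - sconj \<sigma> (a j) u) dvd 1"
    and indep: "i < l \<Longrightarrow> (\<Sum>j<ns i. \<iota> (c j) * \<beta> i j) = 0 \<Longrightarrow> \<forall>j<ns i. c j = 0"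
begin

section \<open>Codewords as values of skew polynomials\<close>

text \<open>The value 0 outside the blocks matches \<open>Mrow\<close>, so equality of functions is
  equality of codewords.\<close>

definition codeword :: "nat \<Rightarrow> (nat \<Rightarrow> 's) \<Rightarrow> nat \<Rightarrow> nat \<Rightarrow> 's" where
  "codeword k f = (\<lambda>i j. if i < l \<and> j < ns i then skew_eval k f (a i) (\<beta> i j) else 0)"

abbreviation n :: nat where "n \<equiv> \<Sum>i<l. ns i"

definition positions :: "(nat \<times> nat) set" where
  "positions = Sigma {..<l} (\<lambda>i. {..<ns i})"

lemma positions: "finite positions" "card positions = n" "(i, j) \<in> positions \<longleftrightarrow> i < l \<and> j < ns i"
  by (auto simp: positions_def)

lemma lincomb_Mrow: "lincomb k f (Mrow \<sigma> l ns a \<beta>) = codeword k f"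
  by (auto simp: lincomb_def Mrow_def codeword_def skew_eval_def fun_eq_iff)

lemma code_C_eq: "code_C \<sigma> l ns a \<beta> k = range (codeword k)"
  unfolding code_C_def span_S_def lincomb_Mrow by auto

lemma codeword_cong: "(\<And>s. s < k \<Longrightarrow> f s = g s) \<Longrightarrow> codeword k f = codeword k g"
  by (auto simp: codeword_def skew_eval_def fun_eq_iff)

lemma codeword_diff: "codeword k (\<lambda>s. f s - g s) i j = codeword k f i j - codeword k g i j"
  by (simp add: codeword_def skew_eval_diff)

lemma codeword_smult: "codeword k (\<lambda>s. c * f s) i j = c * codeword k f i j"
  by (simp add: codeword_def skew_eval_smult)

lemma codeword_eq_0:
  assumes k: "k \<le> n" and 0: "codeword k f = (\<lambda>i j. 0)"
  shows "\<forall>s<k. f s = 0"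
proof (rule skew_zeros_imp_zero[where T = positions and \<beta> = \<beta>, OF a_units conj indep])
  show "skew_eval k f (a i) (\<beta> i j) = 0" if "(i, j) \<in> positions" for i j
    using fun_cong[OF fun_cong[OF 0], of i j] that by (simp add: codeword_def positions(3))
qed (use k positions in auto)

lemma codeword_eq_iff:
  assumes k: "k \<le> n"
  shows "codeword k f = codeword k g \<longleftrightarrow> (\<forall>s<k. f s = g s)"
proof
  assume "codeword k f = codeword k g"
  then have "codeword k (\<lambda>s. f s - g s) = (\<lambda>i j. 0)" by (simp add: codeword_diff fun_eq_iff)
  then show "\<forall>s<k. f s = g s" using codeword_eq_0[OF k] by fastforce
qed (auto intro: codeword_cong)

lemma code_C_free:
  assumes k: "k \<le> n"
  shows "free_of_rank (code_C \<sigma> l ns a \<beta> k) k"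
proof -
  have "Mrow \<sigma> l ns a \<beta> t \<in> code_C \<sigma> l ns a \<beta> k" if "t < k" for t
  proof -
    have "(\<Sum>s<k. (if s = t then 1 else 0) * Mrow \<sigma> l ns a \<beta> s i j) =
        (\<Sum>s<k. if s = t then Mrow \<sigma> l ns a \<beta> t i j else 0)" for i j
      by (intro sum.cong) auto
    then have "lincomb k (\<lambda>s. if s = t then 1 else 0) (Mrow \<sigma> l ns a \<beta>) = Mrow \<sigma> l ns a \<beta> t"
      using that by (simp add: lincomb_def fun_eq_iff)
    then show ?thesis unfolding code_C_def span_S_def by (intro CollectI exI conjI TrueI) (rule sym)
  qed
  then show ?thesis
    unfolding free_of_rank_def
    by (intro exI[of _ "Mrow \<sigma> l ns a \<beta>"]) (auto simp: code_C_def lincomb_Mrow codeword_eq_0[OF k])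
qed

lemma card_code_C:
  assumes k: "k \<le> n"
  shows "card (code_C \<sigma> l ns a \<beta> k) = card (UNIV :: 's set) ^ k"
proof -
  let ?F = "{..<k} \<rightarrow>\<^sub>E (UNIV :: 's set)"
  have "codeword k f \<in> codeword k ` ?F" for f
    by (rule image_eqI[of _ _ "restrict f {..<k}"]) (auto intro: codeword_cong)
  then have "code_C \<sigma> l ns a \<beta> k = codeword k ` ?F" unfolding code_C_eq by auto
  moreover have "inj_on (codeword k) ?F"
    by (intro inj_onI PiE_ext) (auto simp: codeword_eq_iff[OF k])
  ultimately show ?thesis by (simp add: card_image card_PiE)
qed

section \<open>Lower and upper bounds on the sum-rank weight\<close>

lemma wt_SR_codeword_ge:
  assumes k: "k \<le> n" and s: "s < k" "f s \<noteq> 0"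
  shows "n + 1 \<le> wt_SR \<iota> b m l ns (codeword k f) + k"
proof -
  \<comment> \<open>One predicate per block, so that witnesses for all blocks can be chosen
    simultaneously.\<close>
  define wit :: "nat \<Rightarrow> (nat \<Rightarrow> nat \<Rightarrow> 'r) \<Rightarrow> (nat \<Rightarrow> nat \<Rightarrow> 'r) \<Rightarrow> (nat \<Rightarrow> 's) \<Rightarrow> bool" where
    "wit = (\<lambda>i Q Q' v.
      (\<forall>p<ns i. \<forall>j<ns i. (\<Sum>s<ns i. Q' p s * Q s j) = (if p = j then 1 else 0)) \<and>
      v = (\<lambda>j. \<Sum>p<ns i. \<iota> (Q p j) * codeword k f i p) \<and>
      rk \<iota> b m (codeword k f i) (ns i) = card {j. j < ns i \<and> v j \<noteq> 0})"
  have "\<exists>Q Q' v. wit i Q Q' v" for i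
    unfolding wit_def by (rule rk_witness[where t = "ns i" and u = "codeword k f i"]) blast
  then obtain Q Q' v where wit: "\<And>i. wit i (Q i) (Q' i) (v i)"
    by metis
  then have
    inv: "\<And>i p j. p < ns i \<Longrightarrow> j < ns i \<Longrightarrow> (\<Sum>s<ns i. Q' i p s * Q i s j) = (if p = j then 1 else 0)"
    and v: "\<And>i. v i = (\<lambda>j. \<Sum>p<ns i. \<iota> (Q i p j) * codeword k f i p)"
    and rk: "\<And>i. rk \<iota> b m (codeword k f i) (ns i) = card {j. j < ns i \<and> v i j \<noteq> 0}"
    unfolding wit_def by simp_all
  define \<beta>' where "\<beta>' = (\<lambda>i j. \<Sum>p<ns i. \<iota> (Q i p j) * \<beta> i p)"
  have v_eq: "v i j = skew_eval k f (a i) (\<beta>' i j)" if "i < l" for i j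
    unfolding v \<beta>'_def skew_eval_sum using that by (intro sum.cong) (auto simp: codeword_def)
  \<comment> \<open>A relation \<open>c\<close> among the new points makes \<open>Q\<close> times
    \<open>c\<close> vanish by the old independence, and applying \<open>Q'\<close> recovers
    \<open>c\<close>.\<close>
  have indep': "\<forall>j<ns i. c j = 0" if i: "i < l" and 0: "(\<Sum>j<ns i. \<iota> (c j) * \<beta>' i j) = 0" for i c
  proof -
    have "(\<Sum>j<ns i. \<iota> (c j) * \<beta>' i j) = (\<Sum>j<ns i. \<Sum>p<ns i. \<iota> (Q i p j * c j) * \<beta> i p)"
      by (intro sum.cong) (auto simp: \<beta>'_def sum_distrib_left \<iota>_mult mult_ac)
    also have "\<dots> = (\<Sum>p<ns i. \<iota> (\<Sum>j<ns i. Q i p j * c j) * \<beta> i p)"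
      by (subst sum.swap) (simp add: \<iota>_sum sum_distrib_right)
    finally have Qc: "\<forall>p<ns i. (\<Sum>j<ns i. Q i p j * c j) = 0" using 0 by (intro indep[OF i]) simp
    have "c q = 0" if q: "q < ns i" for q
    proof -
      have "c q = (\<Sum>j<ns i. (if q = j then 1 else 0) * c j)"
        using q by (simp add: if_distrib[of "\<lambda>x. x * _"] cong: if_cong)
      also have "\<dots> = (\<Sum>j<ns i. \<Sum>s<ns i. Q' i q s * (Q i s j * c j))"
        using q by (intro sum.cong) (auto simp: inv[symmetric] sum_distrib_right mult.assoc)
      also have "\<dots> = (\<Sum>s<ns i. Q' i q s * (\<Sum>j<ns i. Q i s j * c j))"
        by (subst sum.swap) (simp add: sum_distrib_left)
      also have "\<dots> = 0" using Qc by simp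
      finally show ?thesis .
    qed
    then show ?thesis by blast
  qed
  define Z where "Z = {x \<in> positions. v (fst x) (snd x) = 0}"
  have Z: "finite Z" "Z \<subseteq> positions" using positions(1) by (auto simp: Z_def)
  have "card Z < k"
  proof (rule ccontr)
    assume "\<not> card Z < k"
    then have "\<forall>s<k. f s = 0"
      using positions v_eq by (intro skew_zeros_imp_zero[where T = Z and \<beta> = \<beta>', OF a_units conj indep'])
        (auto simp: Z_def)
    with s show False by blast
  qed
  moreover have "wt_SR \<iota> b m l ns (codeword k f) = card (Sigma {..<l} (\<lambda>i. {j. j < ns i \<and> v i j \<noteq> 0}))"
    by (simp add: wt_SR_def rk)
  moreover have "Sigma {..<l} (\<lambda>i. {j. j < ns i \<and> v i j \<noteq> 0}) = positions - Z"
    by (auto simp: Z_def positions(3))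
  moreover have "card (positions - Z) = n - card Z"
    using Z positions by (simp add: card_Diff_subset)
  ultimately have "card Z < k" "wt_SR \<iota> b m l ns (codeword k f) = n - card Z" by simp_all
  then show ?thesis using k by linarith
qed

text \<open>A codeword vanishing on \<open>k - 1\<close> positions is multiplied into the socle, where rank over the
  chain ring is bounded by the number of nonzero columns by counting over the residue field.\<close>

lemma ex_codeword_wt_SR_le:
  assumes k: "1 \<le> k" "k \<le> n"
  shows "\<exists>f s. s < k \<and> f s \<noteq> 0 \<and> wt_SR \<iota> b m l ns (codeword k f) + k \<le> n + 1"
proof -
  obtain Z where Z: "Z \<subseteq> positions" "card Z = k - 1" "finite Z"
    using k positions by (metis obtain_subset_with_card_n diff_le_self le_trans finite_subset)
  let ?F = "{..<k} \<rightarrow>\<^sub>E (UNIV :: 's set)" and ?G = "Z \<rightarrow>\<^sub>E (UNIV :: 's set)"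
  define \<Phi> where "\<Phi> = (\<lambda>f. restrict (\<lambda>(i, j). codeword k f i j) Z)"
  have S2: "card (UNIV :: 's set) > 1"
  proof -
    have "card {0 :: 's, 1} \<le> card (UNIV :: 's set)" by (rule card_mono[OF finite_S]) simp
    then show ?thesis using zero_neq_one_S by simp
  qed
  have finG: "finite ?G" using Z finite_S by (simp add: finite_PiE)
  \<comment> \<open>Pigeonhole: there are more coefficient vectors of length \<open>k\<close> than
    value vectors on the \<open>k - 1\<close> positions in \<open>Z\<close>. The difference of two
    colliding vectors gives a codeword vanishing on \<open>Z\<close>.\<close>
  have "\<not> inj_on \<Phi> ?F"
  proof
    assume "inj_on \<Phi> ?F"
    moreover have "\<Phi> ` ?F \<subseteq> ?G" by (intro image_subsetI) (simp add: \<Phi>_def PiE_def)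
    ultimately have "card ?F \<le> card ?G" using finG by (metis card_inj_on_le)
    then have "card (UNIV :: 's set) ^ k \<le> card (UNIV :: 's set) ^ (k - 1)"
      using Z by (simp add: card_PiE)
    then show False using S2 k by simp
  qed
  then obtain f g where fg: "f \<in> ?F" "g \<in> ?F" "\<Phi> f = \<Phi> g" "f \<noteq> g" unfolding inj_on_def by blast
  define h where "h = (\<lambda>s. f s - g s)"
  have "\<exists>s<k. h s \<noteq> 0"
  proof (rule ccontr)
    assume "\<not> ?thesis"
    then have "f = g" using fg by (intro PiE_ext) (auto simp: h_def)
    with fg show False by blast
  qed
  then obtain s0 where s0: "s0 < k" "h s0 \<noteq> 0" by blast
  have h0: "codeword k h i j = 0" if "(i, j) \<in> Z" for i j
    using fun_cong[OF fg(3), of "(i, j)"] that by (simp add: \<Phi>_def h_def codeword_diff)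
  \<comment> \<open>With \<open>e\<close> the least power of \<open>p\<close> annihilating
    \<open>h\<close>, the multiple by the preceding power is nonzero but killed by
    \<open>p\<close>.\<close>
  define e where "e = (LEAST e. \<forall>s<k. p ^ e * h s = 0)"
  obtain N where "p ^ N = 0" using p_nilpotent by blast
  then have "\<forall>s<k. p ^ N * h s = 0" by simp
  then have e: "\<forall>s<k. p ^ e * h s = 0" unfolding e_def by (rule LeastI)
  have "e \<noteq> 0" using e s0 by (metis mult_1 power_0)
  then obtain e' where e': "e = Suc e'" by (metis not0_implies_Suc)
  then obtain s1 where s1: "s1 < k" "p ^ e' * h s1 \<noteq> 0"
    using not_less_Least[of e' "\<lambda>e. \<forall>s<k. p ^ e * h s = 0"] by (auto simp: e_def)
  define f' where "f' = (\<lambda>s. p ^ e' * h s)"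
  have c: "codeword k f' i j = p ^ e' * codeword k h i j" for i j
    by (simp add: f'_def codeword_smult)
  have c0: "codeword k f' i j = 0" if "(i, j) \<in> Z" for i j
    using h0 that by (simp add: c)
  have socle: "p * codeword k f' i j = 0" for i j
  proof -
    have "p * codeword k f' i j = codeword k (\<lambda>s. p ^ e * h s) i j"
      by (simp add: c e' codeword_smult mult.assoc)
    also have "\<dots> = codeword k (\<lambda>s. 0) i j" using codeword_cong e by metis
    finally show ?thesis by (simp add: codeword_def skew_eval_def)
  qed
  have "rk \<iota> b m (codeword k f' i) (ns i) \<le> card {j. j < ns i \<and> (i, j) \<notin> Z}" for i
    by (rule rk_le_card_support) (auto simp: socle c0)
  then have "wt_SR \<iota> b m l ns (codeword k f') \<le> (\<Sum>i<l. card {j. j < ns i \<and> (i, j) \<notin> Z})"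
    unfolding wt_SR_def by (intro sum_mono)
  also have "\<dots> = card (Sigma {..<l} (\<lambda>i. {j. j < ns i \<and> (i, j) \<notin> Z}))" by simp
  also have "Sigma {..<l} (\<lambda>i. {j. j < ns i \<and> (i, j) \<notin> Z}) = positions - Z"
    by (auto simp: positions(3))
  also have "card (positions - Z) = n - (k - 1)"
    using Z positions by (simp add: card_Diff_subset)
  finally have "wt_SR \<iota> b m l ns (codeword k f') + k \<le> n + 1" using k by linarith
  then show ?thesis using s1 by (intro exI[of _ f'] exI[of _ s1]) (simp add: f'_def)
qed

section \<open>The minimum distance\<close>

lemma d_SR_code_C:
  assumes k: "1 \<le> k" "k \<le> n"
  shows "d_SR \<iota> b m l ns (code_C \<sigma> l ns a \<beta> k) = n + 1 - k"
proof -
  let ?C = "code_C \<sigma> l ns a \<beta> k"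
  define W where "W = {wt_SR \<iota> b m l ns (\<lambda>i j. c i j - d i j) | c d. c \<in> ?C \<and> d \<in> ?C \<and> c \<noteq> d}"
  \<comment> \<open>By linearity and uniqueness of coefficients, differences of distinct codewords
    are exactly the codewords with some nonzero coefficient, to which both weight bounds
    apply.\<close>
  have W: "W = {wt_SR \<iota> b m l ns (codeword k f) | f. \<exists>s<k. f s \<noteq> 0}"
  proof (intro equalityI subsetI)
    fix w assume "w \<in> W"
    then obtain f g where w: "w = wt_SR \<iota> b m l ns (\<lambda>i j. codeword k f i j - codeword k g i j)"
      and ne: "codeword k f \<noteq> codeword k g"
      unfolding W_def code_C_eq by blast
    have "\<exists>s<k. f s - g s \<noteq> 0" using ne codeword_eq_iff[OF k(2)] by auto
    then show "w \<in> {wt_SR \<iota> b m l ns (codeword k f) | f. \<exists>s<k. f s \<noteq> 0}"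
      unfolding w codeword_diff[symmetric] by blast
  next
    fix w assume "w \<in> {wt_SR \<iota> b m l ns (codeword k f) | f. \<exists>s<k. f s \<noteq> 0}"
    then obtain f where w: "w = wt_SR \<iota> b m l ns (codeword k f)" and f: "\<exists>s<k. f s \<noteq> 0" by blast
    have "codeword k f = (\<lambda>i j. codeword k f i j - codeword k (\<lambda>_. 0) i j)"
      unfolding codeword_diff[symmetric] by simp
    moreover have "codeword k f \<noteq> codeword k (\<lambda>_. 0)" using f codeword_eq_iff[OF k(2)] by auto
    ultimately show "w \<in> W" unfolding W_def code_C_eq w
      by (intro CollectI exI[of _ "codeword k f"] exI[of _ "codeword k (\<lambda>_. 0)"]) auto
  qed
  have finC: "finite ?C"
    using card_code_C[OF k(2)] finite_S by (metis card_gt_0_iff UNIV_not_empty zero_less_power)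
  have sub: "W \<subseteq> (\<lambda>(c, d). wt_SR \<iota> b m l ns (\<lambda>i j. c i j - d i j)) ` (?C \<times> ?C)"
    unfolding W_def by auto
  have fin: "finite W" by (rule finite_subset[OF sub]) (intro finite_imageI finite_cartesian_product finC)
  have ge: "n + 1 - k \<le> w" if "w \<in> W" for w
  proof -
    obtain f s where "s < k" "f s \<noteq> 0" "w = wt_SR \<iota> b m l ns (codeword k f)"
      using \<open>w \<in> W\<close> unfolding W by blast
    then show ?thesis using wt_SR_codeword_ge[OF k(2)] by fastforce
  qed
  obtain f s where f: "s < k" "f s \<noteq> 0" "wt_SR \<iota> b m l ns (codeword k f) + k \<le> n + 1"
    using ex_codeword_wt_SR_le[OF k] by blast
  then have "wt_SR \<iota> b m l ns (codeword k f) \<in> W" unfolding W by blast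
  moreover from this have "wt_SR \<iota> b m l ns (codeword k f) = n + 1 - k"
    using ge f(3) by fastforce
  ultimately have "Min W = n + 1 - k" using fin ge by (intro Min_eqI) auto
  then show ?thesis unfolding d_SR_def W_def .
qed

lemma code_C_MSRD:
  assumes k: "1 \<le> k" "k \<le> n"
  shows "is_MSRD \<iota> b m l ns (code_C \<sigma> l ns a \<beta> k)"
  unfolding is_MSRD_def using card_code_C[OF k(2)] d_SR_code_C[OF k] k
  by (intro exI[of _ k]) (simp add: of_nat_diff)

end

theorem theorem5:
  fixes \<iota> :: "'r::{comm_ring_1,finite} \<Rightarrow> 's::comm_ring_1"
    and h :: "'r poly" and \<alpha> :: 's and \<sigma> :: "'s \<Rightarrow> 's"
    and l :: nat and ns :: "nat \<Rightarrow> nat" and a :: "nat \<Rightarrow> 's" and \<beta> :: "nat \<Rightarrow> nat \<Rightarrow> 's"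
    and k :: nat
  assumes chain: "chain_ring TYPE('r)"
    and h_monic: "lead_coeff h = 1"
    and h_irr: "irreducible_mod (max_ideal :: 'r set) h"
    and \<iota>_hom: "is_ring_hom \<iota>" and \<iota>_inj: "inj \<iota>"
    and S_basis: "bij_betw (\<lambda>c. \<Sum>i<degree h. \<iota> (c i) * \<alpha> ^ i) {c. \<forall>i\<ge>degree h. c i = 0} UNIV"
    and h_root: "poly (map_poly \<iota> h) \<alpha> = 0"
    and \<sigma>_aut: "is_ring_aut \<sigma>"
    and \<sigma>_fix: "{y. \<sigma> y = y} = range \<iota>"
    and \<sigma>_gen: "\<And>\<tau>. is_ring_aut \<tau> \<Longrightarrow> (\<forall>r. \<tau> (\<iota> r) = \<iota> r) \<Longrightarrow> \<exists>j. \<tau> = \<sigma> ^^ j"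
    and \<sigma>_frob: "\<And>y. \<sigma> y - y ^ residue_card (max_ideal :: 'r set) \<in> ext_ideal \<iota> max_ideal"
    and ns_pos: "\<And>i. i < l \<Longrightarrow> ns i > 0"
    and a_units: "\<And>i. i < l \<Longrightarrow> a i dvd 1"
    and cond_i: "\<And>i j b. i < j \<Longrightarrow> j < l \<Longrightarrow> b dvd 1 \<Longrightarrow> (a i - sconj \<sigma> (a j) b) dvd 1"
    and cond_ii: "\<And>i c. i < l \<Longrightarrow> (\<Sum>j<ns i. \<iota> (c j) * \<beta> i j) = 0 \<Longrightarrow> \<forall>j<ns i. c j = 0"
    and k_range: "1 \<le> k" "k \<le> (\<Sum>i<l. ns i)"
  shows "free_of_rank (code_C \<sigma> l ns a \<beta> k) k \<and>
         is_MSRD \<iota> (\<lambda>i. \<alpha> ^ i) (degree h) l ns (code_C \<sigma> l ns a \<beta> k)"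
proof -
  interpret linearized_RS_code \<iota> \<sigma> "\<lambda>i. \<alpha> ^ i" "degree h" l ns a \<beta>
    by unfold_locales
      (fact chain \<iota>_hom \<iota>_inj S_basis \<sigma>_aut \<sigma>_fix \<sigma>_frob a_units cond_i cond_ii)+
  show ?thesis using code_C_free code_C_MSRD k_range by blast
qed

end
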